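(* Let $W:\mathbb{M}\to\mathbb{R}$ be a continuous, bounded from below function on the space $\mathbb{M}$ of real $m\times d$ matrices, of class $C^2$ in a neighborhood of $\{F_+,F_-\}\subset\mathbb{M}$, where $F_+-F_-=a\otimes n$ for some $a\in\mathbb{R}^m$ and some unit vector $n\in\mathbb{R}^d$. Let $\eta\in\mathbb{R}^d$ be a unit vector with $\eta\perp n$, and for $h\in(0,1)$ let $\Phi_h:B\to\mathbb{R}^m$ be the interchange variation defined in the context. Let $\bar y(z)=F_+z$ if $z\cdot n>0$ and $\bar y(z)=F_-z$ if $z\cdot n<0$. Then $$\lim_{h\to0}\frac1h\int_B\{W(\nabla\bar y(z)+\nabla\Phi_h(z))-W(\nabla\bar y(z))\}\,dz=-\frac{\omega_{d-1}}{2}\,\mathfrak{N},$$ where $\mathfrak{N}=(W_F(F_+)-W_F(F_-),\,F_+-F_-)$ and $\omega_k=\pi^{k/2}/\Gamma(k/2+1)$ is the $k$-dimensional volume of the unit ball in $\mathbb{R}^k$.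
   Context: $\mathbb{M}$ carries the Frobenius inner product $(A,B)=\mathrm{Tr}(A^TB)$; $a\otimes n=an^T$; $W_F$ is the gradient of $W$; $B$ is the open unit ball of $\mathbb{R}^d$. Definition of $\Phi_h$. Let $\{\zeta_h:h\in(0,1)\}$ be a family of Lipschitz cut-off functions on $[0,+\infty)$ with $\zeta_h(t)=1$ for $0\le t\le 1-\sqrt h$ and $\zeta_h(t)=0$ for $t\ge1$, with Lipschitz constant at most $C/\sqrt h$ for a constant $C$ independent of $h$. Let $\rho:\mathbb{R}\to\mathbb{R}$ be a Lipschitz cut-off function with $\rho(t)=1$ for $t>1$ and $\rho(t)=0$ for $t<0$. Let $\phi(s)=1$ for $s\le0$, $\phi(s)=1-s$ for $0<s<1$, $\phi(s)=0$ for $s\ge1$. Then $$\Phi_h=\Phi_h^++\Phi_h^-,\qquad \Phi_h^-(z)=\Phi_h^+(-z),\qquad \Phi_h^+(z)=h\,\phi\Big(\frac{z\cdot n}{h}\Big)\rho\Big(\frac{z\cdot\eta}{\sqrt h}\Big)\zeta_h(|z|)\,a.$$ *)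

theory Defs
  imports "HOL-Analysis.Analysis"
begin

definition frobenius :: "real^'d^'m \<Rightarrow> real^'d^'m \<Rightarrow> real" where
  "frobenius A B = trace (transpose A ** B)"

lemma frobenius_eq_inner: "frobenius A B = A \<bullet> B"
proof -
  have "frobenius A B = (\<Sum>j\<in>UNIV. \<Sum>i\<in>UNIV. A $ i $ j * B $ i $ j)"
    by (simp add: frobenius_def trace_def transpose_def matrix_matrix_mult_def)
  also have "\<dots> = A \<bullet> B"
    by (subst sum.swap) (simp add: inner_vec_def)
  finally show ?thesis .
qed

definition outer :: "real^'m \<Rightarrow> real^'d \<Rightarrow> real^'d^'m" where
  "outer a n = (\<chi> i j. a $ i * n $ j)"

text \<open>The gradient of a function of matrices with respect to the Frobenius inner product;
  meaningful only where the function is differentiable.\<close>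

definition matrix_gradient :: "(real^'d^'m \<Rightarrow> real) \<Rightarrow> real^'d^'m \<Rightarrow> real^'d^'m" where
  "matrix_gradient W F = (THE G. (W has_derivative (\<lambda>H. frobenius G H)) (at F))"

lemma matrix_gradient_eqI:
  assumes "(W has_derivative (\<lambda>H. frobenius G H)) (at F)"
  shows "matrix_gradient W F = G"
  unfolding matrix_gradient_def
proof (rule the_equality)
  show "(W has_derivative (\<lambda>H. frobenius G H)) (at F)" by (rule assms)
next
  fix G' assume "(W has_derivative (\<lambda>H. frobenius G' H)) (at F)"
  then have "(\<lambda>H. G' \<bullet> H) = (\<lambda>H. G \<bullet> H)"
    using has_derivative_unique assms by (simp add: frobenius_eq_inner) blast
  then show "G' = G" by (metis vector_eq_rdot inner_commute)
qed

text \<open>Class \<open>C\<^sup>2\<close> on an open set: the first two Frechet derivatives exist and the second one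
  is continuous for the operator norm.\<close>

definition C2_on :: "'a::real_normed_vector set \<Rightarrow> ('a \<Rightarrow> 'b::real_normed_vector) \<Rightarrow> bool" where
  "C2_on U f \<longleftrightarrow> open U \<and>
    (\<exists>(Df :: 'a \<Rightarrow> ('a \<Rightarrow>\<^sub>L 'b)) (D2f :: 'a \<Rightarrow> ('a \<Rightarrow>\<^sub>L ('a \<Rightarrow>\<^sub>L 'b))).
      (\<forall>x\<in>U. (f has_derivative blinfun_apply (Df x)) (at x)) \<and>
      (\<forall>x\<in>U. (Df has_derivative blinfun_apply (D2f x)) (at x)) \<and>
      continuous_on U D2f)"

definition phi :: "real \<Rightarrow> real" where
  "phi s = (if s \<le> 0 then 1 else if s < 1 then 1 - s else 0)"

definition Phi_plus ::
  "real^'m \<Rightarrow> real^'d \<Rightarrow> real^'d \<Rightarrow> (real \<Rightarrow> real \<Rightarrow> real) \<Rightarrow> (real \<Rightarrow> real) \<Rightarrow> real \<Rightarrow> real^'d \<Rightarrow> real^'m"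
where
  "Phi_plus a n \<eta> \<zeta> \<rho> h z =
     (h * phi ((z \<bullet> n) / h) * \<rho> ((z \<bullet> \<eta>) / sqrt h) * \<zeta> h (norm z)) *\<^sub>R a"

definition Phi_minus ::
  "real^'m \<Rightarrow> real^'d \<Rightarrow> real^'d \<Rightarrow> (real \<Rightarrow> real \<Rightarrow> real) \<Rightarrow> (real \<Rightarrow> real) \<Rightarrow> real \<Rightarrow> real^'d \<Rightarrow> real^'m"
where
  "Phi_minus a n \<eta> \<zeta> \<rho> h z = Phi_plus a n \<eta> \<zeta> \<rho> h (- z)"

definition Phi ::
  "real^'m \<Rightarrow> real^'d \<Rightarrow> real^'d \<Rightarrow> (real \<Rightarrow> real \<Rightarrow> real) \<Rightarrow> (real \<Rightarrow> real) \<Rightarrow> real \<Rightarrow> real^'d \<Rightarrow> real^'m"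
where
  "Phi a n \<eta> \<zeta> \<rho> h z = Phi_plus a n \<eta> \<zeta> \<rho> h z + Phi_minus a n \<eta> \<zeta> \<rho> h z"

end

theory Submission
  imports Defs
begin

text \<open>Write \<open>\<Phi>\<^sub>h = g\<^sub>h a\<close> with a scalar Lipschitz function \<open>g\<^sub>h\<close>, which is even; by the reflection
  \<open>z \<mapsto> - z\<close> it suffices to treat the half ball \<open>z \<bullet> n > 0\<close>, with energy \<open>w p = W (F + a \<otimes> p)\<close>
  evaluated at \<open>p = \<nabla>g\<^sub>h\<close>. Split \<open>w p = w 0 + q \<bullet> p + r p\<close> with \<open>r p = o(\<bar>p\<bar>)\<close>.

  By the divergence theorem the linear part integrates to \<open>- (q \<bullet> n)\<close> times the integral of \<open>g\<^sub>h\<close> over the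
  disc \<open>z \<bullet> n = 0\<close>, where \<open>g\<^sub>h / h \<longrightarrow> 1\<close>: this contributes \<open>- \<omega> (q \<bullet> n)\<close>. In the layer
  \<open>0 < z \<bullet> n < h\<close> the gradient is \<open>- n\<close> on the half with \<open>z \<bullet> \<eta> > 0\<close> and \<open>0\<close> on the other half, up
  to a vanishing fraction: the contribution is \<open>(\<omega> / 2) r (- n)\<close>. Outside the layer the gradient is of order
  \<open>\<surd>h\<close> and supported in a set of measure of order \<open>\<surd>h\<close>, so that \<open>r\<close> contributes \<open>o(h)\<close>. Adding
  up, \<open>W F\<^sub>+\<close> and \<open>W F\<^sub>-\<close> cancel between the two half balls. Rademacher's theorem is only needed for
  functions of one real variable, since \<open>g\<^sub>h\<close> is composed of such functions.\<close>

section \<open>Lipschitz functions of one real variable\<close>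

text \<open>The splitting of \<open>w\<close> is forced by the scaling. Outside the layer the
  gradient has size \<open>sqrt h\<close> on a set of size \<open>sqrt h\<close>, so estimating
  absolute values leaves the linear term of order \<open>h\<close>, the order of the limit itself;
  only a superlinear remainder gains anything there. The linear term must therefore be integrated
  exactly, over the layer and its exterior together. The factor 1/2 of the limit survives because
  the two contributions count different sets: the linear part sees the whole disc and gives
  \<open>- \<omega> (q \<bullet> n)\<close>, while the layer sees half of it and returns
  \<open>(\<omega> / 2) (q \<bullet> n)\<close> through
  \<open>r (- n) = w (- n) - w 0 + q \<bullet> n\<close>. The values of \<open>W\<close> cancel
  because subtracting \<open>a \<otimes> n\<close> from \<open>F\<^sub>+\<close> gives
  \<open>F\<^sub>-\<close> and adding it to \<open>F\<^sub>-\<close> gives \<open>F\<^sub>+\<close>: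
  the variation interchanges the two gradients. The layer shrinks with \<open>h\<close>. Stretching
  its normal variable by \<open>1 / h\<close> moves all integrals over it to one fixed product
  space, where dominated convergence applies.\<close>

lemma null_upper_density_set:
  fixes k :: "'a::euclidean_space \<Rightarrow> ennreal"
  assumes [measurable]: "k \<in> borel_measurable borel"
    and fin: "(\<integral>\<^sup>+x\<in>ball 0 R. k x \<partial>lborel) < \<infinity>"
    and cp: "0 \<le> c" "c < p"
  shows "negligible {x \<in> ball 0 R. k x < ennreal c \<and>
    (\<forall>\<delta>>0. \<exists>t. 0 < t \<and> t < \<delta> \<and> ennreal p * emeasure lborel (ball x t) < (\<integral>\<^sup>+y\<in>ball x t. k y \<partial>lborel))}"
    (is "negligible ?N")
proof -
  \<comment> \<open>Vitali covering argument: the set \<open>A\<close> where \<open>k < c\<close> is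
    enclosed in an open \<open>U\<close> of almost the same mass, and disjoint balls inside
    \<open>U\<close> on which \<open>k\<close> has mean above \<open>p\<close> cover
    \<open>?N\<close> up to a null set. Their union \<open>G\<close> carries mass at least
    \<open>p\<close> times its volume, but at most \<open>c\<close> times its volume plus the excess
    of \<open>U\<close> over \<open>A\<close>; so its volume is small.\<close>
  have "\<exists>T. ?N \<subseteq> T \<and> T \<in> lmeasurable \<and> measure lebesgue T < e" if e: "e > 0" for e
  proof -
    \<comment> \<open>With this excess mass the final inequality
      \<open>(p - c) * measure lborel G \<le> \<epsilon>\<close> yields \<open>e / 2\<close>,
      strictly below \<open>e\<close>.\<close>
    define \<epsilon> where "\<epsilon> = (p - c) * e / 2"
    have \<epsilon>: "\<epsilon> > 0" using e cp by (simp add: \<epsilon>_def)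
    define A where "A = {x \<in> ball 0 R. k x < ennreal c}"
    have A[measurable]: "A \<in> sets borel" unfolding A_def by measurable
    define m where "m = density lborel k"
    \<comment> \<open>Outer regularity is applied to a finite measure; cutting \<open>k\<close> off
      outside the ball makes it finite.\<close>
    define M where "M = density lborel (\<lambda>x. k x * indicator (ball 0 R) x)"
    have m_eq: "emeasure m X = (\<integral>\<^sup>+y\<in>X. k y \<partial>lborel)" if "X \<in> sets borel" for X
      using that by (simp add: m_def emeasure_density)
    have M_eq: "emeasure M X = emeasure m (X \<inter> ball 0 R)" if "X \<in> sets borel" for X
    proof -
      have "emeasure M X = (\<integral>\<^sup>+y. k y * indicator (X \<inter> ball 0 R) y \<partial>lborel)"
        using that unfolding M_def
        by (subst emeasure_density, measurable, simp)
           (auto intro!: nn_integral_cong split: split_indicator)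
      then show ?thesis using that by (simp add: m_eq)
    qed
    have [simp]: "sets M = sets borel" "sets m = sets borel" by (auto simp: M_def m_def)
    have finM: "emeasure M X < \<infinity>" if "X \<in> sets borel" for X
      using fin that by (simp add: M_eq m_eq)
        (rule le_less_trans[rotated], assumption, rule nn_integral_mono, auto split: split_indicator)
    have "emeasure M A = (INF U \<in> {U. A \<subseteq> U \<and> open U}. emeasure M U)"
      by (rule outer_regular) (use finM[of "space M"] in \<open>auto simp: M_def\<close>)
    moreover have "emeasure M A < emeasure M A + ennreal \<epsilon>"
      using finM[OF A] \<epsilon> by (simp add: ennreal_add_left_cancel_less less_top top.not_eq_extremum)
    ultimately obtain U where U: "A \<subseteq> U" "open U" "emeasure M U < emeasure M A + ennreal \<epsilon>"
      by (metis (mono_tags, lifting) INF_less_iff mem_Collect_eq)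
    have [measurable]: "U \<in> sets borel" using U by auto
    have "emeasure M (U - A) = emeasure M U - emeasure M A"
      using U finM[OF A] by (intro emeasure_Diff) auto
    also have "\<dots> \<le> ennreal \<epsilon>"
      using U(3) finM[OF A] by (auto simp: ennreal_minus_le_iff)
    finally have MUA: "emeasure M (U - A) \<le> ennreal \<epsilon>" .
    define K where "K = {(x,t). 0 < t \<and> ball x t \<subseteq> U \<inter> ball 0 R \<and>
      ennreal p * emeasure lborel (ball x t) < emeasure m (ball x t)}"
    have cover: "\<exists>i. i \<in> K \<and> x \<in> ball (fst i) (snd i) \<and> snd i < d" if x: "x \<in> ?N" "0 < d" for x d
    proof -
      have "x \<in> A" using x by (auto simp: A_def)
      then have "x \<in> U \<inter> ball 0 R" using U by (auto simp: A_def)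
      moreover have "open (U \<inter> ball 0 R)" using U by auto
      ultimately obtain r where r: "r > 0" "ball x r \<subseteq> U \<inter> ball 0 R"
        using openE by blast
      have "\<forall>\<delta>>0. \<exists>t. 0 < t \<and> t < \<delta> \<and> ennreal p * emeasure lborel (ball x t) < (\<integral>\<^sup>+y\<in>ball x t. k y \<partial>lborel)"
        using x by blast
      moreover have "min r d > 0" using r x by simp
      ultimately obtain t where t: "0 < t" "t < min r d"
        "ennreal p * emeasure lborel (ball x t) < (\<integral>\<^sup>+y\<in>ball x t. k y \<partial>lborel)"
        by blast
      have "ball x t \<subseteq> ball x r" using t by auto
      then have "(x,t) \<in> K" using t r by (auto simp: K_def m_eq)
      then show ?thesis using t by (intro exI[of _ "(x,t)"]) auto
    qed
    obtain C where C: "countable C" "C \<subseteq> K"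
      "pairwise (\<lambda>i j. disjnt (ball (fst i) (snd i)) (ball (fst j) (snd j))) C"
      "negligible (?N - (\<Union>i \<in> C. ball (fst i) (snd i)))"
      using Vitali_covering_theorem_balls[of ?N K fst snd, OF cover] by blast
    define G where "G = (\<Union>i \<in> C. ball (fst i) (snd i))"
    have Gsub: "G \<subseteq> U \<inter> ball 0 R" using C(2) by (force simp: G_def K_def)
    have Go: "open G" by (auto simp: G_def)
    then have G[measurable]: "G \<in> sets borel" by auto
    have disj: "disjoint_family_on (\<lambda>i. ball (fst i) (snd i)) C"
      using C(3) by (auto simp: disjoint_family_on_def pairwise_def disjnt_def)
    have "ennreal p * emeasure lborel G = (\<integral>\<^sup>+i. ennreal p * emeasure lborel (ball (fst i) (snd i)) \<partial>count_space C)"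
      unfolding G_def using C(1) disj by (subst emeasure_UN_countable) (auto simp: nn_integral_cmult)
    also have "\<dots> \<le> (\<integral>\<^sup>+i. emeasure m (ball (fst i) (snd i)) \<partial>count_space C)"
      using C(2) by (intro nn_integral_mono) (auto simp: K_def less_imp_le)
    also have "\<dots> = emeasure m G"
      unfolding G_def using C(1) disj by (subst emeasure_UN_countable) auto
    also have "\<dots> \<le> emeasure m ((G \<inter> A) \<union> ((U - A) \<inter> ball 0 R))"
      using Gsub by (intro emeasure_mono) auto
    also have "\<dots> \<le> emeasure m (G \<inter> A) + emeasure m ((U - A) \<inter> ball 0 R)"
      by (intro emeasure_subadditive) auto
    also have "\<dots> \<le> ennreal c * emeasure lborel G + ennreal \<epsilon>"
    proof (rule add_mono)
      have "emeasure m (G \<inter> A) \<le> (\<integral>\<^sup>+y. ennreal c * indicator G y \<partial>lborel)"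
        by (subst m_eq) (auto intro!: nn_integral_mono simp: A_def less_imp_le split: split_indicator)
      then show "emeasure m (G \<inter> A) \<le> ennreal c * emeasure lborel G"
        by (simp add: nn_integral_cmult)
      show "emeasure m ((U - A) \<inter> ball 0 R) \<le> ennreal \<epsilon>" using MUA by (simp add: M_eq)
    qed
    finally have ineq: "ennreal p * emeasure lborel G \<le> ennreal c * emeasure lborel G + ennreal \<epsilon>" .
    have "emeasure lborel G \<le> emeasure lborel (ball (0::'a) R)"
      using Gsub by (intro emeasure_mono) auto
    also have "\<dots> < \<infinity>" using emeasure_lborel_ball_finite by blast
    finally have Gfin: "emeasure lborel G < \<infinity>" .
    then have G_eq: "emeasure lborel G = ennreal (measure lborel G)"
      by (simp add: emeasure_eq_ennreal_measure less_top)
    have "p * measure lborel G \<le> c * measure lborel G + \<epsilon>"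
      using ineq cp \<epsilon> unfolding G_eq
      by (simp add: ennreal_mult[symmetric] ennreal_plus[symmetric] del: ennreal_plus)
    then have "(p - c) * measure lborel G \<le> \<epsilon>"
      by (simp add: algebra_simps)
    then have "(p - c) * measure lborel G \<le> (p - c) * (e / 2)"
      by (simp add: \<epsilon>_def)
    then have Gle: "measure lborel G \<le> e / 2" using cp by simp
    have Gl: "G \<in> lmeasurable" using Gfin by (simp add: fmeasurable_def)
    have neg: "negligible (?N - G)" using C(4) by (simp add: G_def)
    have lm: "G \<union> (?N - G) \<in> lmeasurable"
      using Gl neg by (intro fmeasurable.Un) (auto simp: negligible_iff_measure)
    have "measure lebesgue (G \<union> (?N - G)) \<le> measure lebesgue G + measure lebesgue (?N - G)"
      using Gl neg by (intro measure_Un_le) (auto simp: negligible_iff_measure)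
    also have "measure lebesgue (?N - G) = 0" using neg negligible_imp_measure0 by blast
    also have "measure lebesgue G = measure lborel G" by (simp add: measure_completion)
    finally have "measure lebesgue (G \<union> (?N - G)) < e" using Gle e by simp
    then show ?thesis using lm by (intro exI[of _ "G \<union> (?N - G)"]) blast
  qed
  then show ?thesis by (subst negligible_outer) blast
qed

text \<open>Countably many exceptional sets suffice: whenever \<open>k x < p\<close>, two rationals
  fit strictly between \<open>k x\<close> and \<open>p\<close>, and \<open>x\<close> lies in a ball
  of integer radius. This makes one null set serve all real \<open>p\<close> at once.\<close>

lemma AE_upper_density:
  fixes k :: "'a::euclidean_space \<Rightarrow> ennreal"
  assumes k[measurable]: "k \<in> borel_measurable borel"
    and fin: "\<And>R. (\<integral>\<^sup>+x\<in>ball 0 R. k x \<partial>lborel) < \<infinity>"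
  shows "AE x in lebesgue. \<forall>p>0. k x < ennreal p \<longrightarrow> (\<exists>\<delta>>0. \<forall>t. 0 < t \<and> t < \<delta> \<longrightarrow>
    (\<integral>\<^sup>+y\<in>ball x t. k y \<partial>lborel) \<le> ennreal p * emeasure lborel (ball x t))"
proof -
  define N where "N R c p = {x \<in> ball 0 R. k x < ennreal c \<and>
    (\<forall>\<delta>>0. \<exists>t. 0 < t \<and> t < \<delta> \<and> ennreal p * emeasure lborel (ball x t) < (\<integral>\<^sup>+y\<in>ball x t. k y \<partial>lborel))}"
    for R c p
  define I :: "((real \<times> real) \<times> real) set" where "I = {(c,p). c \<in> \<rat> \<and> p \<in> \<rat> \<and> 0 \<le> c \<and> c < p} \<times> (\<nat>::real set)"
  have cI: "countable I"
  proof -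
    have "I \<subseteq> (\<rat> \<times> \<rat>) \<times> \<nat>" by (auto simp: I_def)
    moreover have "countable ((\<rat> \<times> \<rat>) \<times> (\<nat>::real set))"
      by (intro countable_SIGMA countable_rat) (auto simp: Nats_def)
    ultimately show ?thesis by (rule countable_subset)
  qed
  have "negligible (\<Union>((\<lambda>((c,p),R). N R c p) ` I))"
  proof (rule negligible_countable_Union)
    show "countable ((\<lambda>((c,p),R). N R c p) ` I)" using cI by simp
    fix X assume "X \<in> (\<lambda>((c,p),R). N R c p) ` I"
    then obtain c p R where X: "X = N R c p" and cp: "0 \<le> c" "c < p"
      by (auto simp: I_def)
    show "negligible X"
      unfolding X N_def by (rule null_upper_density_set[OF k fin cp])
  qed
  then have "AE x in lebesgue. x \<notin> (\<Union>((\<lambda>((c,p),R). N R c p) ` I))"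
    unfolding negligible_iff_null_sets by (rule AE_not_in)
  then show ?thesis
  proof (rule AE_mp, intro AE_I2 impI allI)
    fix x p assume x: "x \<notin> (\<Union>((\<lambda>((c,p),R). N R c p) ` I))" and p: "(0::real) < p" "k x < ennreal p"
    obtain R where R: "norm x < R" "R \<in> \<nat>" using reals_Archimedean2[of "norm x"] by auto
    have "k x < top" using p by (metis order_less_le_trans top_greatest)
    define kk where "kk = enn2real (k x)"
    have kk: "k x = ennreal kk" "0 \<le> kk" using \<open>k x < top\<close> by (auto simp: kk_def)
    then have "kk < p" using p by (simp add: ennreal_less_iff)
    then obtain c q where cq: "c \<in> \<rat>" "q \<in> \<rat>" "kk < c" "c < q" "q < p"
      by (metis Rats_dense_in_real)
    then have "((c,q),R) \<in> I" using R kk by (auto simp: I_def)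
    then have "x \<notin> N R c q" using x by force
    moreover have "x \<in> ball 0 R" "k x < ennreal c"
      using R kk cq by (auto simp: ennreal_less_iff)
    ultimately obtain \<delta> where \<delta>: "\<delta> > 0" "\<And>t. 0 < t \<Longrightarrow> t < \<delta> \<Longrightarrow> (\<integral>\<^sup>+y\<in>ball x t. k y \<partial>lborel) \<le> ennreal q * emeasure lborel (ball x t)"
      unfolding N_def mem_Collect_eq using linorder_not_le by blast
    have "(\<integral>\<^sup>+y\<in>ball x t. k y \<partial>lborel) \<le> ennreal p * emeasure lborel (ball x t)" if "0 < t" "t < \<delta>" for t
    proof -
      have "ennreal q * emeasure lborel (ball x t) \<le> ennreal p * emeasure lborel (ball x t)"
        using cq by (intro mult_right_mono ennreal_leI) auto
      then show ?thesis using \<delta>(2)[OF that] by (rule order_trans[rotated])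
    qed
    then show "\<exists>\<delta>>0. \<forall>t. 0 < t \<and> t < \<delta> \<longrightarrow>
      (\<integral>\<^sup>+y\<in>ball x t. k y \<partial>lborel) \<le> ennreal p * emeasure lborel (ball x t)"
      using \<delta> by blast
  qed
qed

text \<open>The image of Lebesgue measure under the inverse of \<open>F\<close> has a Radon-Nikodym density \<open>k\<close>, of which
  \<open>F\<close> is a primitive. Applying \<open>AE_upper_density\<close> to \<open>\<bar>k - q\<bar>\<close> for all rational \<open>q\<close> gives \<open>F' = k\<close> almost everywhere.\<close>
lemma lipschitz_expansive_AE_differentiable:
  fixes F :: "real \<Rightarrow> real"
  assumes exp: "\<And>x y. x \<le> y \<Longrightarrow> y - x \<le> F y - F x"
    and lip: "\<And>x y. \<bar>F y - F x\<bar> \<le> M * \<bar>y - x\<bar>"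
  shows "AE x in lebesgue. F differentiable at x"
proof -
  have mono: "F x \<le> F y \<longleftrightarrow> x \<le> y" for x y
    using exp[of x y] exp[of y x] by linarith
  then have smono: "F x < F y \<longleftrightarrow> x < y" for x y
    by (metis not_le)
  have contF: "continuous_on S F" for S
  proof (rule continuous_on_subset[OF lipschitz_on_continuous_on])
    show "(max M 0)-lipschitz_on UNIV F"
    proof (rule lipschitz_onI)
      fix x y
      have "M * \<bar>x - y\<bar> \<le> max M 0 * \<bar>x - y\<bar>" by (intro mult_right_mono) auto
      then show "dist (F x) (F y) \<le> max M 0 * dist x y"
        using lip[where x=y and y=x] by (simp add: dist_real_def)
    qed simp
  qed simp
  have "surj F"
    unfolding surj_def
  proof
    fix y
    define r where "r = \<bar>y - F 0\<bar>"
    have "F (- r) \<le> y" "y \<le> F r" "- r \<le> r"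
      using exp[of "-r" 0] exp[of 0 r] by (auto simp: r_def)
    then show "\<exists>x. y = F x" using IVT'[of F "-r" y r] contF by blast
  qed
  moreover have "inj F" by (rule injI) (metis mono order_antisym order_refl)
  ultimately have bij: "bij F" by (simp add: bij_def)
  define G where "G = inv F"
  have FG[simp]: "F (G y) = y" and GF[simp]: "G (F x) = x" for x y
    using bij by (simp_all add: G_def bij_is_inj bij_is_surj surj_f_inv_f)
  have "mono G" by (rule monoI) (metis FG mono)
  then have G[measurable]: "G \<in> borel_measurable borel" by (rule borel_measurable_mono)
  define \<mu> where "\<mu> = distr lborel borel G"
  have [simp]: "sets \<mu> = sets borel" by (simp add: \<mu>_def)
  have \<mu>_ivl: "emeasure \<mu> {a<..<b} = ennreal (F b - F a)" if "a \<le> b" for a b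
  proof -
    have "G -` {a<..<b} = {F a<..<F b}" using smono by auto (metis FG smono)+
    then have "emeasure \<mu> {a<..<b} = emeasure lborel {F a<..<F b}"
      by (simp add: \<mu>_def emeasure_distr)
    also have "\<dots> = ennreal (F b - F a)" using that mono by (intro emeasure_lborel_Ioo) auto
    finally show ?thesis .
  qed
  \<comment> \<open>Preimages under \<open>G\<close> are images under \<open>F\<close>, and a
    Lipschitz map sends null sets to null sets.\<close>
  have ac: "absolutely_continuous lborel \<mu>"
    unfolding absolutely_continuous_def
  proof
    fix A :: "real set" assume A: "A \<in> null_sets lborel"
    then have "negligible A" by (simp add: negligible_iff_null_sets null_sets_completionI)
    then have "negligible (F ` A)"
      by (rule negligible_locally_Lipschitz_image[OF order_refl])
         (use lip in \<open>auto intro!: exI[of _ UNIV]\<close>)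
    moreover have "G -` A = F ` A" by (auto simp: image_iff) (metis FG)
    ultimately have "G -` A \<in> null_sets lebesgue" by (simp add: negligible_iff_null_sets)
    moreover have "G -` A \<in> sets borel" using A measurable_sets[OF G, of A] by auto
    ultimately have "emeasure lborel (G -` A) = 0"
      by (simp add: null_sets_def)
    then show "A \<in> null_sets \<mu>" using A by (auto simp: null_sets_def \<mu>_def emeasure_distr)
  qed
  define k where "k = RN_deriv lborel \<mu>"
  have k[measurable]: "k \<in> borel_measurable borel" by (simp add: k_def)
  have dens: "density lborel k = \<mu>"
    unfolding k_def by (rule sigma_finite_measure.density_RN_deriv[OF sigma_finite_lborel ac]) simp
  have k_ivl: "(\<integral>\<^sup>+x\<in>{a<..<b}. k x \<partial>lborel) = ennreal (F b - F a)" if "a \<le> b" for a b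
    using \<mu>_ivl[OF that] by (simp add: dens[symmetric] emeasure_density)
  have "sigma_finite_measure \<mu>"
  proof
    show "\<exists>A. countable A \<and> A \<subseteq> sets \<mu> \<and> \<Union>A = space \<mu> \<and> (\<forall>a\<in>A. emeasure \<mu> a \<noteq> \<infinity>)"
    proof (intro exI[of _ "range (\<lambda>n::nat. {- real n<..<real n})"] conjI)
      show "\<Union>(range (\<lambda>n::nat. {- real n<..<real n})) = space \<mu>"
        by (auto simp: \<mu>_def) (metis abs_less_iff reals_Archimedean2 minus_less_iff)
    qed (auto simp: \<mu>_ivl)
  qed
  then have fin: "AE x in lebesgue. k x \<noteq> \<infinity>"
    unfolding k_def by (intro AE_completion sigma_finite_measure.RN_deriv_finite[OF sigma_finite_lborel _ ac]) auto
  define d where "d q x = ennreal \<bar>enn2real (k x) - q\<bar>" for q x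
  have d[measurable]: "d q \<in> borel_measurable borel" for q unfolding d_def by measurable
  have [measurable]: "ball x r \<in> sets borel" for x r :: real by simp
  have "AE x in lebesgue. \<forall>q::rat. 0 \<le> q \<longrightarrow> (\<forall>p>0. d (of_rat q) x < ennreal p \<longrightarrow> (\<exists>\<delta>>0. \<forall>t. 0 < t \<and> t < \<delta> \<longrightarrow>
    (\<integral>\<^sup>+y\<in>ball x t. d (of_rat q) y \<partial>lborel) \<le> ennreal p * emeasure lborel (ball x t)))"
    unfolding AE_all_countable
  proof (intro allI)
    fix q :: rat
    show "AE x in lebesgue. 0 \<le> q \<longrightarrow> (\<forall>p>0. d (of_rat q) x < ennreal p \<longrightarrow> (\<exists>\<delta>>0. \<forall>t. 0 < t \<and> t < \<delta> \<longrightarrow>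
      (\<integral>\<^sup>+y\<in>ball x t. d (of_rat q) y \<partial>lborel) \<le> ennreal p * emeasure lborel (ball x t)))"
    proof (cases "0 \<le> q")
      case True
      have "(\<integral>\<^sup>+x\<in>ball 0 R. d (of_rat q) x \<partial>lborel) < \<infinity>" for R
      proof -
        have "(\<integral>\<^sup>+x\<in>ball 0 R. d (of_rat q) x \<partial>lborel) \<le>
          (\<integral>\<^sup>+x. k x * indicator (ball 0 R) x + ennreal (of_rat q) * indicator (ball 0 R) x \<partial>lborel)"
        proof (rule nn_integral_mono)
          fix x :: real
          have "0 \<le> (of_rat q :: real)" using True by simp
          then have "ennreal \<bar>r - of_rat q\<bar> \<le> ennreal r + ennreal (of_rat q)" if "0 \<le> r" for r
          proof -
            have "\<bar>r - of_rat q\<bar> \<le> r + (of_rat q :: real)"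
              using that \<open>0 \<le> (of_rat q :: real)\<close> by linarith
            from ennreal_leI[OF this] show ?thesis
              using that True by (simp add: ennreal_plus)
          qed
          then have "d (of_rat q) x \<le> k x + ennreal (of_rat q)"
            unfolding d_def by (cases "k x") auto
          then show "d (of_rat q) x * indicator (ball 0 R) x \<le>
            k x * indicator (ball 0 R) x + ennreal (of_rat q) * indicator (ball 0 R) x"
            by (auto split: split_indicator)
        qed
        also have "\<dots> = (\<integral>\<^sup>+x\<in>ball 0 R. k x \<partial>lborel) + ennreal (of_rat q) * emeasure lborel (ball (0::real) R)"
          by (subst nn_integral_add, measurable) (simp add: nn_integral_cmult_indicator)
        also have "\<dots> < \<infinity>"
        proof -
          have "(\<integral>\<^sup>+x\<in>ball 0 R. k x \<partial>lborel) < \<infinity>"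
          proof (cases "R \<ge> 0")
            case True
            then show ?thesis by (simp add: ball_eq_greaterThanLessThan k_ivl)
          qed simp
          moreover have "ennreal (of_rat q) * emeasure lborel (ball (0::real) R) < \<infinity>"
            using emeasure_lborel_ball_finite[of "0::real" R] by (simp add: ennreal_mult_less_top)
          ultimately show ?thesis by simp
        qed
        finally show ?thesis .
      qed
      from AE_upper_density[OF d this] show ?thesis by eventually_elim auto
    qed auto
  qed
  then show ?thesis using fin
  proof eventually_elim
    case (elim x)
    define h where "h = enn2real (k x)"
    have h0: "0 \<le> h" by (simp add: h_def)
    \<comment> \<open>The factor 3: the average of \<open>\<bar>k - q\<bar>\<close> is controlled on
      the ball of length \<open>2 * s\<close> around \<open>x\<close>, although only the interval of
      length \<open>s\<close> between \<open>x\<close> and \<open>y\<close> is integrated over,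
      which costs \<open>2 * \<epsilon>\<close>; replacing \<open>q\<close> by \<open>h\<close>
      costs one more \<open>\<epsilon>\<close>.\<close>
    have est: "\<exists>\<delta>>0. \<forall>y. \<bar>y - x\<bar> < \<delta> \<longrightarrow> \<bar>F y - F x - h * (y - x)\<bar> \<le> 3 * \<epsilon> * \<bar>y - x\<bar>" if \<epsilon>: "\<epsilon> > 0" for \<epsilon>
    proof -
      \<comment> \<open>Taking \<open>q\<close> above \<open>h\<close> keeps it nonnegative, so that
        its image in \<open>ennreal\<close> is not truncated to 0.\<close>
      obtain q where q: "h < of_rat q" "of_rat q < h + \<epsilon>"
        using of_rat_dense[of h "h + \<epsilon>"] \<epsilon> by auto
      define qr where "qr = (of_rat q :: real)"
      have q0: "0 \<le> qr" using q h0 unfolding qr_def by linarith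
      then have "0 \<le> q" by (simp add: qr_def)
      have "\<bar>h - qr\<bar> < \<epsilon>" using q unfolding qr_def by linarith
      then have "d qr x < ennreal \<epsilon>" unfolding d_def h_def[symmetric] by (intro ennreal_lessI \<epsilon>)
      then have "\<exists>\<delta>>0. \<forall>t. 0 < t \<and> t < \<delta> \<longrightarrow>
          (\<integral>\<^sup>+y\<in>ball x t. d qr y \<partial>lborel) \<le> ennreal \<epsilon> * emeasure lborel (ball x t)"
        unfolding qr_def by (rule elim(1)[rule_format, OF \<open>0 \<le> q\<close> \<epsilon>])
      then obtain \<delta> where \<delta>: "\<delta> > 0" and D: "\<And>t. 0 < t \<Longrightarrow> t < \<delta> \<Longrightarrow>
        (\<integral>\<^sup>+y\<in>ball x t. d qr y \<partial>lborel) \<le> ennreal \<epsilon> * emeasure lborel (ball x t)"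
        by blast
      have "\<bar>F y - F x - h * (y - x)\<bar> \<le> 3 * \<epsilon> * \<bar>y - x\<bar>" if y: "\<bar>y - x\<bar> < \<delta>" for y
      proof (cases "y = x")
        case False
        define s where "s = \<bar>y - x\<bar>"
        define a b where "a = min x y" and "b = max x y"
        have s: "0 < s" "s < \<delta>" "a \<le> b" "b - a = s" using False y by (auto simp: s_def a_def b_def)
        have sub: "{a<..<b} \<subseteq> ball x s" by (auto simp: a_def b_def s_def dist_real_def)
        have J: "(\<integral>\<^sup>+y\<in>{a<..<b}. d qr y \<partial>lborel) \<le> ennreal (2 * \<epsilon> * s)"
        proof -
          have "(\<integral>\<^sup>+y\<in>{a<..<b}. d qr y \<partial>lborel) \<le> (\<integral>\<^sup>+y\<in>ball x s. d qr y \<partial>lborel)"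
            using sub by (intro nn_integral_mono) (auto split: split_indicator)
          also have "\<dots> \<le> ennreal \<epsilon> * emeasure lborel (ball x s)" by (rule D) (use s in auto)
          also have "emeasure lborel (ball x s) = ennreal (2 * s)"
            using s by (simp add: ball_eq_greaterThanLessThan)
          finally show ?thesis using \<epsilon> s by (simp add: ennreal_mult[symmetric] mult_ac)
        qed
        have "AE z in lborel. k z \<noteq> \<infinity>"
          using fin by (rule AE_completion_iff[THEN iffD1, rotated])
        have "ennreal (F b - F a) \<le> ennreal (qr * s + 2 * \<epsilon> * s)"
        proof -
          have "ennreal (F b - F a) = (\<integral>\<^sup>+x\<in>{a<..<b}. k x \<partial>lborel)" using k_ivl s by simp
          also have "\<dots> \<le> (\<integral>\<^sup>+x. ennreal qr * indicator {a<..<b} x + d qr x * indicator {a<..<b} x \<partial>lborel)"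
          proof (rule nn_integral_mono_AE)
            show "AE z in lborel. k z * indicator {a<..<b} z \<le> ennreal qr * indicator {a<..<b} z + d qr z * indicator {a<..<b} z"
              using \<open>AE z in lborel. k z \<noteq> \<infinity>\<close>
            proof eventually_elim
              case (elim z)
              then have "k z = ennreal (enn2real (k z))" by (simp add: less_top)
              also have "\<dots> \<le> ennreal qr + d qr z"
                using q0 unfolding d_def by (simp add: ennreal_plus[symmetric] ennreal_leI del: ennreal_plus)
              finally show ?case by (auto split: split_indicator)
            qed
          qed
          also have "\<dots> = ennreal qr * emeasure lborel {a<..<b} + (\<integral>\<^sup>+y\<in>{a<..<b}. d qr y \<partial>lborel)"
            by (subst nn_integral_add, measurable) (simp add: nn_integral_cmult_indicator)
          also have "\<dots> \<le> ennreal qr * ennreal s + ennreal (2 * \<epsilon> * s)"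
            using J s by (intro add_mono) auto
          finally show ?thesis using q0 s \<epsilon> by (simp add: ennreal_mult[symmetric] ennreal_plus[symmetric] del: ennreal_plus)
        qed
        then have up: "F b - F a \<le> qr * s + 2 * \<epsilon> * s"
          using q0 s \<epsilon> by (subst (asm) ennreal_le_iff) auto
        have "ennreal (qr * s) \<le> ennreal (F b - F a + 2 * \<epsilon> * s)"
        proof -
          have "ennreal (qr * s) = (\<integral>\<^sup>+x. ennreal qr * indicator {a<..<b} x \<partial>lborel)"
            using q0 s by (simp add: nn_integral_cmult ennreal_mult)
          also have "\<dots> \<le> (\<integral>\<^sup>+x. k x * indicator {a<..<b} x + d qr x * indicator {a<..<b} x \<partial>lborel)"
          proof (rule nn_integral_mono)
            fix z
            have "ennreal qr \<le> k z + d qr z"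
              using q0 unfolding d_def
              by (cases "k z") (auto simp: ennreal_plus[symmetric] simp del: ennreal_plus intro!: ennreal_leI)
            then show "ennreal qr * indicator {a<..<b} z \<le> k z * indicator {a<..<b} z + d qr z * indicator {a<..<b} z"
              by (auto split: split_indicator)
          qed
          also have "\<dots> = ennreal (F b - F a) + (\<integral>\<^sup>+y\<in>{a<..<b}. d qr y \<partial>lborel)"
            using s by (subst nn_integral_add, measurable) (simp add: k_ivl)
          also have "\<dots> \<le> ennreal (F b - F a) + ennreal (2 * \<epsilon> * s)" using J by (rule add_left_mono)
          finally show ?thesis using exp[OF s(3)] s \<epsilon> by (simp add: ennreal_plus[symmetric] del: ennreal_plus)
        qed
        then have lo: "qr * s \<le> F b - F a + 2 * \<epsilon> * s"
          using exp[OF s(3)] s \<epsilon> by (subst (asm) ennreal_le_iff) auto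
        have "\<bar>qr * s - h * s\<bar> \<le> \<epsilon> * s"
        proof -
          have "\<bar>qr * s - h * s\<bar> = (qr - h) * s"
            using q s by (simp add: qr_def abs_mult left_diff_distrib[symmetric])
          also have "\<dots> \<le> \<epsilon> * s" using q s by (intro mult_right_mono) (auto simp: qr_def)
          finally show ?thesis .
        qed
        then have "\<bar>F b - F a - h * s\<bar> \<le> 3 * \<epsilon> * s" using up lo by linarith
        moreover have "\<bar>F y - F x - h * (y - x)\<bar> = \<bar>F b - F a - h * s\<bar>"
          unfolding a_def b_def s_def by (cases "x \<le> y") (auto simp: min_def max_def algebra_simps)
        ultimately show ?thesis by (simp add: s_def)
      qed simp
      then show ?thesis using \<delta> by blast
    qed
    have "(F has_derivative (\<lambda>t. h * t)) (at x)"
      unfolding has_derivative_at_alt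
    proof (intro conjI allI impI)
      show "bounded_linear ((*) h)" by (rule bounded_linear_mult_right)
      fix e :: real assume "e > 0"
      then show "\<exists>d>0. \<forall>y. norm (y - x) < d \<longrightarrow> norm (F y - F x - h * (y - x)) \<le> e * norm (y - x)"
        using est[of "e / 3"] by simp
    qed
    then show ?case by (rule differentiableI)
  qed
qed

text \<open>Adding the linear function \<open>(L + 1) * x\<close> makes every increment at least
  \<open>y - x\<close> without affecting differentiability.\<close>

lemma lipschitz_real_negligible_nondifferentiable:
  fixes f :: "real \<Rightarrow> real"
  assumes "L-lipschitz_on UNIV f"
  shows "negligible {x. \<not> f differentiable at x}"
proof -
  have L: "\<bar>f y - f x\<bar> \<le> L * \<bar>y - x\<bar>" for x y
    using lipschitz_onD[OF assms, of y x] by (simp add: dist_real_def)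
  have L0: "0 \<le> L" using assms by (rule lipschitz_on_nonneg)
  define F where "F x = f x + (L + 1) * x" for x
  have "AE x in lebesgue. F differentiable at x"
  proof (rule lipschitz_expansive_AE_differentiable)
    fix x y :: real
    show "y - x \<le> F y - F x" if "x \<le> y"
      using L[of y x] that by (simp add: F_def algebra_simps)
    have "\<bar>F y - F x\<bar> \<le> \<bar>f y - f x\<bar> + \<bar>(L + 1) * (y - x)\<bar>" by (simp add: F_def algebra_simps)
    also have "\<dots> \<le> L * \<bar>y - x\<bar> + (L + 1) * \<bar>y - x\<bar>" using L[of y x] L0 by (simp add: abs_mult)
    finally show "\<bar>F y - F x\<bar> \<le> (2 * L + 1) * \<bar>y - x\<bar>" by (simp add: algebra_simps)
  qed
  then have "AE x in lebesgue. f differentiable at x"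
  proof eventually_elim
    case (elim x)
    then have "(\<lambda>x. F x - (L + 1) * x) differentiable at x" by (intro derivative_intros) auto
    then show ?case by (simp add: F_def)
  qed
  then obtain N where "N \<in> null_sets lebesgue" "{x. \<not> f differentiable at x} \<subseteq> N"
    by (auto simp: eventually_ae_filter)
  then show ?thesis using negligible_subset negligible_iff_null_sets by blast
qed

section \<open>Null sets and difference quotients\<close>

lemma null_sets_lborel_borel_superset:
  assumes "negligible (N :: 'a::euclidean_space set)"
  obtains N' where "N \<subseteq> N'" "N' \<in> null_sets lborel"
  using assms unfolding negligible_iff_null_sets null_sets_completion_iff2 by blast

text \<open>The indicator of the cylinder is a product of functions of single coordinates. The
  factor for \<open>b\<close> has integral 0, and 0 absorbs the infinite integrals of the other
  factors.\<close>

lemma negligible_vimage_coordinate: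
  fixes b :: "'a::euclidean_space"
  assumes "b \<in> Basis" "negligible N"
  shows "negligible {x. x \<bullet> b \<in> N}"
proof -
  obtain N' where N': "N \<subseteq> N'" "N' \<in> null_sets lborel"
    using null_sets_lborel_borel_superset[OF assms(2)] .
  then have [measurable]: "N' \<in> sets borel" by auto
  define f where "f c = (if c = b then indicator N' else (\<lambda>_. 1) :: real \<Rightarrow> ennreal)" for c :: 'a
  have "emeasure lborel {x. x \<bullet> b \<in> N'} = (\<integral>\<^sup>+x. indicator {x. x \<bullet> b \<in> N'} x \<partial>lborel)"
    by (subst nn_integral_indicator) auto
  also have "\<dots> = (\<integral>\<^sup>+x. (\<Prod>c\<in>Basis. f c (x \<bullet> c)) \<partial>lborel)"
  proof (rule nn_integral_cong)
    fix x :: 'a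
    have "(\<Prod>c\<in>Basis. f c (x \<bullet> c)) = (\<Prod>c\<in>Basis. if c = b then indicator N' (x \<bullet> b) else 1)"
      by (intro prod.cong) (auto simp: f_def)
    also have "\<dots> = indicator N' (x \<bullet> b)" using assms by (simp add: prod.delta)
    finally show "indicator {x. x \<bullet> b \<in> N'} x = (\<Prod>c\<in>Basis. f c (x \<bullet> c))"
      by (simp add: indicator_def)
  qed
  also have "\<dots> = (\<Prod>c\<in>Basis. (\<integral>\<^sup>+x. f c x \<partial>lborel))"
    by (rule nn_integral_lborel_prod) (auto simp: f_def)
  also have "\<dots> = 0"
    using assms(1) N'(2) by (intro prod_zero) (auto simp: f_def null_sets_def intro!: bexI[of _ b])
  finally have "{x. x \<bullet> b \<in> N'} \<in> null_sets lborel" by (auto simp: null_sets_def)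
  then have "negligible {x. x \<bullet> b \<in> N'}"
    by (simp add: negligible_iff_null_sets null_sets_completionI)
  then show ?thesis by (rule negligible_subset) (use N' in auto)
qed

text \<open>The chain rule for an outer function with a null set \<open>N\<close> of bad points
  requires that the inner function avoid \<open>N\<close> almost everywhere. Where
  \<open>G x \<bullet> b \<noteq> 0\<close>, replacing the \<open>b\<close>-coordinate of
  \<open>x\<close> by \<open>g x\<close> is a map with injective derivative, and it turns the set
  into the preimage of a coordinate cylinder over \<open>N\<close>. A nonzero \<open>G x\<close> is
  detected by some basis vector, and there are finitely many.\<close>

lemma negligible_vimage_submersion:
  fixes g :: "'a::euclidean_space \<Rightarrow> real"
  assumes N: "negligible N"
    and der: "\<And>x. x \<in> S \<Longrightarrow> (g has_derivative (\<lambda>h. G x \<bullet> h)) (at x)"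
    and nz: "\<And>x. x \<in> S \<Longrightarrow> G x \<noteq> 0"
  shows "negligible {x \<in> S. g x \<in> N}"
proof -
  have *: "negligible {x \<in> {x \<in> S. G x \<bullet> b \<noteq> 0}. x + (g x - x \<bullet> b) *\<^sub>R b \<in> {y. y \<bullet> b \<in> N}}"
    if b: "b \<in> Basis" for b
  proof (rule negligible_differentiable_vimage)
    show "negligible {y. y \<bullet> b \<in> N}" by (rule negligible_vimage_coordinate[OF b N])
    fix x assume x: "x \<in> {x \<in> S. G x \<bullet> b \<noteq> 0}"
    show "((\<lambda>x. x + (g x - x \<bullet> b) *\<^sub>R b) has_derivative (\<lambda>h. h + (G x \<bullet> h - h \<bullet> b) *\<^sub>R b))
      (at x within {x \<in> S. G x \<bullet> b \<noteq> 0})"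
    proof -
      have "(g has_derivative (\<lambda>h. G x \<bullet> h)) (at x within {x \<in> S. G x \<bullet> b \<noteq> 0})"
        using der x has_derivative_at_withinI by blast
      then show ?thesis by (intro derivative_intros)
    qed
    have "linear (\<lambda>h. h + (G x \<bullet> h - h \<bullet> b) *\<^sub>R b)"
      by (rule linearI) (auto simp: inner_simps algebra_simps)
    moreover have "h = 0" if h: "h + (G x \<bullet> h - h \<bullet> b) *\<^sub>R b = 0" for h
    proof -
      have "(h + (G x \<bullet> h - h \<bullet> b) *\<^sub>R b) \<bullet> b = 0" using h by simp
      then have "G x \<bullet> h = 0" using b by (simp add: inner_simps inner_Basis)
      moreover from this h have "h = (h \<bullet> b) *\<^sub>R b" by (simp add: algebra_simps)
      ultimately have "(h \<bullet> b) * (G x \<bullet> b) = 0" by (metis inner_scaleR_right)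
      then have "h \<bullet> b = 0" using x by simp
      with \<open>h = (h \<bullet> b) *\<^sub>R b\<close> show ?thesis by (metis scale_zero_left)
    qed
    ultimately show "inj (\<lambda>h. h + (G x \<bullet> h - h \<bullet> b) *\<^sub>R b)"
      by (subst linear_injective_0) blast+
  qed
  define T where "T b = {x \<in> {x \<in> S. G x \<bullet> b \<noteq> 0}. x + (g x - x \<bullet> b) *\<^sub>R b \<in> {y. y \<bullet> b \<in> N}}" for b
  have "negligible (\<Union>(T ` Basis))"
    by (rule negligible_Union) (use * in \<open>auto simp: T_def\<close>)
  moreover have "{x \<in> S. g x \<in> N} \<subseteq> \<Union>(T ` Basis)"
  proof
    fix x assume x: "x \<in> {x \<in> S. g x \<in> N}"
    then obtain b where b: "b \<in> Basis" "G x \<bullet> b \<noteq> 0"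
      using nz by (metis (no_types, lifting) euclidean_all_zero_iff mem_Collect_eq)
    then have "x \<in> T b"
      using x by (auto simp: T_def inner_simps inner_Basis)
    then show "x \<in> \<Union>(T ` Basis)" using b by auto
  qed
  ultimately show ?thesis by (rule negligible_subset)
qed

lemma negligible_imp_AE_lborel:
  assumes "negligible N"
  shows "AE x in lborel. x \<notin> N"
proof -
  have "AE x in lebesgue. x \<notin> N" using assms unfolding negligible_iff_null_sets by (rule AE_not_in)
  then show ?thesis by (rule AE_completion_iff[THEN iffD1, rotated])
qed

lemma AE_lborel_not_hyperplane:
  fixes a :: "'a::euclidean_space"
  assumes "a \<noteq> 0"
  shows "AE z in lborel. z \<bullet> a \<noteq> c"
proof -
  have "negligible {z. a \<bullet> z = c}" by (rule negligible_hyperplane) (use assms in auto)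
  then have "AE z in lborel. z \<notin> {z. a \<bullet> z = c}" by (rule negligible_imp_AE_lborel)
  then show ?thesis by eventually_elim (simp add: inner_commute)
qed

lemma integral_lborel_reflect:
  fixes f :: "'a::euclidean_space \<Rightarrow> real"
  assumes [measurable]: "f \<in> borel_measurable borel"
  shows "(\<integral>z. f (- z) \<partial>lborel) = (\<integral>z. f z \<partial>lborel)"
proof -
  have "(\<integral>z. f z \<partial>lborel) = (\<integral>z. f z \<partial>distr lborel borel uminus)"
    using lborel_affine[of "-1" "0::'a"] by (simp add: density_1)
  also have "\<dots> = (\<integral>z. f (- z) \<partial>lborel)" by (rule integral_distr) auto
  finally show ?thesis ..
qed

lemma continuous_bounded_on_cball:
  fixes f :: "'a::euclidean_space \<Rightarrow> real"
  assumes "continuous_on UNIV f"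
  obtains c where "\<And>x. norm x \<le> K \<Longrightarrow> \<bar>f x\<bar> \<le> c"
proof -
  have "compact (f ` cball 0 K)"
    by (intro compact_continuous_image continuous_on_subset[OF assms]) auto
  then have "bounded (f ` cball 0 K)" by (rule compact_imp_bounded)
  then obtain c where "\<forall>y\<in>f ` cball 0 K. norm y \<le> c" by (auto simp: bounded_iff)
  then show ?thesis by (intro that[of c]) auto
qed

lemma has_real_derivative_along_line:
  fixes g :: "'a::euclidean_space \<Rightarrow> real"
  assumes "(g has_derivative (\<lambda>w. u \<bullet> w)) (at x)"
  shows "((\<lambda>t. g (x + t *\<^sub>R q)) has_real_derivative (u \<bullet> q)) (at 0)"
proof -
  have "((\<lambda>t. g (x + t *\<^sub>R q)) has_derivative (\<lambda>t. u \<bullet> (t *\<^sub>R q))) (at 0)"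
  proof (rule has_derivative_compose[of "\<lambda>t. x + t *\<^sub>R q" "\<lambda>t. t *\<^sub>R q" 0 UNIV g])
    show "((\<lambda>t. x + t *\<^sub>R q) has_derivative (\<lambda>t. t *\<^sub>R q)) (at 0)"
      by (auto intro!: derivative_eq_intros)
  qed (use assms in simp)
  then show ?thesis by (simp add: has_field_derivative_def mult_commute_abs)
qed

lemma difference_quotient_LIMSEQ:
  fixes g :: "'a::euclidean_space \<Rightarrow> real"
  assumes "(g has_derivative (\<lambda>w. u \<bullet> w)) (at x)"
  shows "(\<lambda>k. (g (x + inverse (real (Suc k)) *\<^sub>R q) - g x) / inverse (real (Suc k))) \<longlonglongrightarrow> u \<bullet> q"
proof -
  have "((\<lambda>t. (g (x + t *\<^sub>R q) - g x) / t) \<longlongrightarrow> u \<bullet> q) (at 0)"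
    using has_real_derivative_along_line[OF assms, of q] by (simp add: DERIV_def)
  moreover have "filterlim (\<lambda>k. inverse (real (Suc k))) (at 0) sequentially"
    by (intro filterlim_atI LIMSEQ_inverse_real_of_nat) auto
  ultimately show ?thesis by (rule filterlim_compose)
qed

section \<open>Slicing by hyperplanes\<close>

text \<open>Uniqueness of Haar measure: integrating \<open>\<lambda>(x, y). A x * B (x + y)\<close> in both orders shows that a
  translation-invariant measure is proportional to Lebesgue measure.\<close>
lemma distr_lborel_orthogonal:
  fixes Q :: "'a::euclidean_space \<Rightarrow> 'a"
  assumes Q: "orthogonal_transformation Q"
  shows "distr lborel borel Q = lborel"
proof -
  have lin: "linear Q" and nQ: "\<And>x. norm (Q x) = norm x" and bij: "bij Q"
    using Q by (auto simp: orthogonal_transformation_linear orthogonal_transformation_norm orthogonal_transformation_bij)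
  have Qm[measurable]: "Q \<in> borel_measurable borel"
    using lin by (intro borel_measurable_continuous_onI linear_continuous_on) (simp add: linear_conv_bounded_linear)
  define \<mu> where "\<mu> = distr lborel borel Q"
  have [simp, measurable_cong]: "sets \<mu> = sets borel" by (simp add: \<mu>_def)
  have [simp]: "space \<mu> = UNIV" by (simp add: \<mu>_def)
  have ball: "emeasure \<mu> (ball 0 r) = emeasure lborel (ball 0 r :: 'a set)" for r
    unfolding \<mu>_def by (subst emeasure_distr) (auto intro!: arg_cong[of _ _ "emeasure lborel"] simp: nQ)
  interpret \<mu>: sigma_finite_measure \<mu>
  proof
    show "\<exists>A. countable A \<and> A \<subseteq> sets \<mu> \<and> \<Union>A = space \<mu> \<and> (\<forall>a\<in>A. emeasure \<mu> a \<noteq> \<infinity>)"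
    proof (intro exI[of _ "range (\<lambda>n::nat. ball 0 (real n))"] conjI)
      show "\<Union>(range (\<lambda>n::nat. ball 0 (real n))) = space \<mu>"
        using reals_Archimedean2 by fastforce
      show "\<forall>a\<in>range (\<lambda>n::nat. ball 0 (real n)). emeasure \<mu> a \<noteq> \<infinity>"
        using emeasure_lborel_ball_finite[of "0::'a"] by (auto simp: ball) (metis less_irrefl)
    qed auto
  qed
  interpret pair_sigma_finite \<mu> "lborel :: 'a measure" ..
  have shift_l: "(\<integral>\<^sup>+y. f (c + y) \<partial>lborel) = (\<integral>\<^sup>+y. f y \<partial>lborel)"
    if [measurable]: "f \<in> borel_measurable borel" for f and c :: 'a
    by (subst lborel_distr_plus[of c, symmetric], subst nn_integral_distr) auto
  have refl_l: "(\<integral>\<^sup>+y. f (c - y) \<partial>lborel) = (\<integral>\<^sup>+y. f y \<partial>lborel)"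
    if [measurable]: "f \<in> borel_measurable borel" for f and c :: 'a
  proof -
    have "(\<integral>\<^sup>+y. f y \<partial>lborel) = (\<integral>\<^sup>+y. f (c + y) \<partial>lborel)" by (simp add: shift_l)
    also have "\<dots> = (\<integral>\<^sup>+y. f (c + y) \<partial>distr lborel borel uminus)"
      using lborel_affine[of "-1" "0::'a"] by (simp add: density_1)
    also have "\<dots> = (\<integral>\<^sup>+y. f (c - y) \<partial>lborel)"
      by (subst nn_integral_distr) auto
    finally show ?thesis ..
  qed
  have shift_\<mu>: "(\<integral>\<^sup>+x. f (x + c) \<partial>\<mu>) = (\<integral>\<^sup>+x. f x \<partial>\<mu>)"
    if [measurable]: "f \<in> borel_measurable borel" for f and c :: 'a
  proof -
    \<comment> \<open>Translating by \<open>Q b\<close> after applying \<open>Q\<close> is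
      translating by \<open>b\<close> before it.\<close>
    obtain b where b: "c = Q b" using bij by (metis bij_pointE)
    have "(\<integral>\<^sup>+x. f (x + c) \<partial>\<mu>) = (\<integral>\<^sup>+x. f (Q (b + x)) \<partial>lborel)"
      unfolding \<mu>_def by (subst nn_integral_distr) (auto simp: b linear_add[OF lin] add.commute)
    also have "\<dots> = (\<integral>\<^sup>+x. f (Q x) \<partial>lborel)" by (rule shift_l[of "\<lambda>x. f (Q x)"]) measurable
    also have "\<dots> = (\<integral>\<^sup>+x. f x \<partial>\<mu>)" unfolding \<mu>_def by (subst nn_integral_distr) auto
    finally show ?thesis .
  qed
  have proportional: "emeasure \<mu> A * emeasure lborel B = emeasure \<mu> B * emeasure lborel A"
    if [measurable]: "A \<in> sets borel" "B \<in> sets borel" for A B :: "'a set"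
  proof -
    have "emeasure \<mu> A * emeasure lborel B = (\<integral>\<^sup>+x. indicator A x * (\<integral>\<^sup>+y. indicator B y \<partial>lborel) \<partial>\<mu>)"
      by (simp add: nn_integral_multc)
    also have "\<dots> = (\<integral>\<^sup>+x. (\<integral>\<^sup>+y. indicator A x * indicator B (x + y) \<partial>lborel) \<partial>\<mu>)"
    proof (rule nn_integral_cong)
      fix x
      have "(\<integral>\<^sup>+y. indicator B y \<partial>lborel) = (\<integral>\<^sup>+y. indicator B (x + y) \<partial>lborel)"
        by (rule shift_l[symmetric]) measurable
      then show "indicator A x * (\<integral>\<^sup>+y. indicator B y \<partial>lborel) = (\<integral>\<^sup>+y. indicator A x * indicator B (x + y) \<partial>lborel)"
        by (subst nn_integral_cmult) auto
    qed
    also have "\<dots> = (\<integral>\<^sup>+y. (\<integral>\<^sup>+x. indicator A x * indicator B (x + y) \<partial>\<mu>) \<partial>lborel)"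
      by (rule Fubini'[symmetric]) measurable
    also have "\<dots> = (\<integral>\<^sup>+y. (\<integral>\<^sup>+x. indicator A (x - y) * indicator B x \<partial>\<mu>) \<partial>lborel)"
    proof (rule nn_integral_cong)
      fix y :: 'a
      show "(\<integral>\<^sup>+x. indicator A x * indicator B (x + y) \<partial>\<mu>) = (\<integral>\<^sup>+x. indicator A (x - y) * indicator B x \<partial>\<mu>)"
        using shift_\<mu>[of "\<lambda>x. indicator A (x - y) * indicator B x" y] by simp
    qed
    also have "\<dots> = (\<integral>\<^sup>+x. (\<integral>\<^sup>+y. indicator A (x - y) * indicator B x \<partial>lborel) \<partial>\<mu>)"
      by (rule Fubini') measurable
    also have "\<dots> = (\<integral>\<^sup>+x. emeasure lborel A * indicator B x \<partial>\<mu>)"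
    proof (rule nn_integral_cong)
      fix x
      have "(\<integral>\<^sup>+y. indicator A (x - y) \<partial>lborel) = emeasure lborel A"
        by (subst refl_l) auto
      then show "(\<integral>\<^sup>+y. indicator A (x - y) * indicator B x \<partial>lborel) = emeasure lborel A * indicator B x"
        by (subst nn_integral_multc) auto
    qed
    also have "\<dots> = emeasure \<mu> B * emeasure lborel A"
      using that by (subst nn_integral_cmult_indicator) (simp_all add: mult.commute)
    finally show ?thesis .
  qed
  have "emeasure \<mu> A = emeasure lborel A" if "A \<in> sets borel" for A
  proof -
    \<comment> \<open>\<open>Q\<close> preserves the unit ball, whose measure is positive and
      finite, so the factor of proportionality is 1.\<close>
    let ?b = "emeasure lborel (ball (0::'a) 1)"
    have "unit_ball_vol (real DIM('a)) \<noteq> 0"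
      using unit_ball_vol_pos[of "real DIM('a)"] by linarith
    then have b: "?b \<noteq> 0" "?b \<noteq> \<infinity>"
      by (simp_all add: emeasure_ball)
    have "?b * emeasure \<mu> A = ?b * emeasure lborel A"
      using proportional[OF that, of "ball 0 1"] by (simp add: ball mult.commute)
    then show ?thesis using b by (simp add: ennreal_mult_cancel_left)
  qed
  then have "\<mu> = lborel" by (intro measure_eqI) auto
  then show ?thesis by (simp add: \<mu>_def)
qed

text \<open>\<open>E\<close> parametrises the hyperplane orthogonal to \<open>n\<close>, and \<open>\<nu>\<close> is its Lebesgue measure. An abstract
  parameter space is used because there is no type of dimension \<open>CARD('d) - 1\<close>.\<close>
locale slicing = sigma_finite_measure \<nu> for \<nu> :: "'i measure" +
  fixes n :: "real^'d" and E :: "'i \<Rightarrow> real^'d"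
  assumes norm_n: "norm n = 1"
    and E_meas[measurable]: "E \<in> borel_measurable \<nu>"
    and E_n: "\<And>f. E f \<bullet> n = 0"
    and nn_slice: "\<And>F. F \<in> borel_measurable borel \<Longrightarrow>
      (\<integral>\<^sup>+z. F z \<partial>lborel) = (\<integral>\<^sup>+f. \<integral>\<^sup>+s. F (s *\<^sub>R n + E f) \<partial>lborel \<partial>\<nu>)"
    and cball_slice: "\<And>r. 0 < r \<Longrightarrow> emeasure \<nu> {f\<in>space \<nu>. norm (E f) \<le> r} =
      ennreal (unit_ball_vol (real CARD('d) - 1) * r ^ (CARD('d) - 1))"

text \<open>An orthogonal map takes a basis vector \<open>e\<close> to \<open>n\<close>. The
  remaining coordinates with their product measure parametrise the hyperplane, and rotation
  invariance of Lebesgue measure transports Fubini's theorem from the coordinate hyperplane to this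
  one.\<close>

lemma slicing_exists:
  fixes n :: "real^'d"
  assumes n: "norm n = 1"
  obtains \<nu> :: "(real^'d \<Rightarrow> real) measure" and E where "slicing \<nu> n E"
proof -
  obtain e :: "real^'d" where e: "e \<in> Basis" using nonempty_Basis by blast
  obtain Q where Q: "orthogonal_transformation Q" and Qe: "Q e = n"
    using orthogonal_transformation_exists_1[of e n] e n by auto
  have lin: "linear Q" and nQ: "\<And>x. norm (Q x) = norm x"
    using Q by (auto simp: orthogonal_transformation_linear orthogonal_transformation_norm)
  have Qm[measurable]: "Q \<in> borel_measurable borel"
    using lin by (intro borel_measurable_continuous_onI linear_continuous_on) (simp add: linear_conv_bounded_linear)
  define I where "I = Basis - {e}"
  have I: "finite I" "e \<notin> I" "insert e I = Basis" using e by (auto simp: I_def)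
  define \<nu> where "\<nu> = Pi\<^sub>M I (\<lambda>_. lborel :: real measure)"
  define S :: "(real^'d \<Rightarrow> real) \<Rightarrow> real^'d" where "S f = (\<Sum>b\<in>I. f b *\<^sub>R b)" for f
  define E where "E f = Q (S f)" for f
  interpret product_sigma_finite "\<lambda>_. lborel :: real measure" by standard
  interpret finite_product_sigma_finite "\<lambda>_. lborel :: real measure" I by standard (use I in auto)
  have [measurable]: "S \<in> borel_measurable \<nu>" unfolding S_def \<nu>_def by measurable
  have "slicing \<nu> n E"
  proof
    show "\<exists>A. countable A \<and> A \<subseteq> sets \<nu> \<and> \<Union>A = space \<nu> \<and> (\<forall>a\<in>A. emeasure \<nu> a \<noteq> \<infinity>)"
      unfolding \<nu>_def by (rule sigma_finite_countable)
    show "norm n = 1" by fact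
    show [measurable]: "E \<in> borel_measurable \<nu>" unfolding E_def by measurable
    show "E f \<bullet> n = 0" for f
    proof -
      have "S f \<bullet> e = 0"
        unfolding S_def using e by (auto simp: inner_sum_left I_def inner_Basis intro!: sum.neutral)
      then show ?thesis
        using Q by (simp add: E_def Qe[symmetric] orthogonal_transformation_def)
    qed
    show "(\<integral>\<^sup>+z. F z \<partial>lborel) = (\<integral>\<^sup>+f. \<integral>\<^sup>+s. F (s *\<^sub>R n + E f) \<partial>lborel \<partial>\<nu>)"
      if [measurable]: "F \<in> borel_measurable borel" for F
    proof -
      have "(\<integral>\<^sup>+z. F z \<partial>lborel) = (\<integral>\<^sup>+z. F (Q z) \<partial>lborel)"
        by (subst distr_lborel_orthogonal[OF Q, symmetric], subst nn_integral_distr) auto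
      also have "\<dots> = (\<integral>\<^sup>+f. F (Q (\<Sum>b\<in>Basis. f b *\<^sub>R b)) \<partial>Pi\<^sub>M (insert e I) (\<lambda>_. lborel))"
        unfolding I by (subst lborel_eq, subst nn_integral_distr) auto
      also have "\<dots> = (\<integral>\<^sup>+f. \<integral>\<^sup>+s. F (Q (\<Sum>b\<in>Basis. (f(e := s)) b *\<^sub>R b)) \<partial>lborel \<partial>\<nu>)"
        unfolding \<nu>_def by (rule product_nn_integral_insert[OF I(1,2)]) (unfold I, measurable)
      also have "\<dots> = (\<integral>\<^sup>+f. \<integral>\<^sup>+s. F (s *\<^sub>R n + E f) \<partial>lborel \<partial>\<nu>)"
      proof (intro nn_integral_cong)
        fix f :: "real^'d \<Rightarrow> real" and s :: real
        have "(\<Sum>b\<in>insert e I. (f(e := s)) b *\<^sub>R b) = s *\<^sub>R e + S f"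
          using I(1,2) by (subst sum.insert) (auto simp: S_def intro!: sum.cong)
        then show "F (Q (\<Sum>b\<in>Basis. (f(e := s)) b *\<^sub>R b)) = F (s *\<^sub>R n + E f)"
          by (simp add: I linear_add[OF lin] linear_scale[OF lin] Qe E_def)
      qed
      finally show ?thesis .
    qed
    show "emeasure \<nu> {f\<in>space \<nu>. norm (E f) \<le> r} = ennreal (unit_ball_vol (real CARD('d) - 1) * r ^ (CARD('d) - 1))"
      if r: "0 < r" for r
    proof -
      have "norm (E f) = sqrt (\<Sum>i\<in>I. (f i)\<^sup>2)" for f
      proof -
        have "norm (E f) = norm (S f)" by (simp add: E_def nQ)
        also have "\<dots> = sqrt (\<Sum>b\<in>Basis. (S f \<bullet> b)\<^sup>2)"
          by (simp add: norm_eq_sqrt_inner euclidean_inner[of "S f" "S f"] power2_eq_square)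
        also have "(\<Sum>b\<in>Basis. (S f \<bullet> b)\<^sup>2) = (\<Sum>b\<in>Basis. if b \<in> I then (f b)\<^sup>2 else 0)"
        proof (rule sum.cong)
          fix b :: "real^'d" assume b: "b \<in> Basis"
          have "S f \<bullet> b = (\<Sum>c\<in>I. if c = b then f c else 0)"
            unfolding S_def inner_sum_left using b by (intro sum.cong) (auto simp: I_def inner_Basis)
          also have "\<dots> = (if b \<in> I then f b else 0)" using I(1) by (simp add: sum.delta')
          finally show "(S f \<bullet> b)\<^sup>2 = (if b \<in> I then (f b)\<^sup>2 else 0)" by simp
        qed simp
        also have "\<dots> = (\<Sum>i\<in>I. (f i)\<^sup>2)"
          by (subst sum.inter_restrict[symmetric]) (auto intro!: sum.cong simp: I_def)
        finally show ?thesis .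
      qed
      then have "{f\<in>space \<nu>. norm (E f) \<le> r} = {f. sqrt (\<Sum>i\<in>I. (f i)\<^sup>2) \<le> r} \<inter> space (Pi\<^sub>M I (\<lambda>_. lborel))"
        by (auto simp: \<nu>_def)
      moreover have "card I = CARD('d) - 1" using e by (simp add: I_def)
      ultimately show ?thesis
        using emeasure_cball_aux[OF I(1) r] by (simp add: \<nu>_def of_nat_diff Suc_leI)
    qed
  qed
  then show thesis by (rule that)
qed

section \<open>Fubini's theorem and the measures of discs in a slicing\<close>

context slicing
begin

sublocale P: pair_sigma_finite "lborel :: real measure" \<nu> ..

text \<open>The height is measured in units of \<open>\<tau>\<close>: with \<open>\<tau> = h\<close>
  a layer of thickness \<open>h\<close> becomes the fixed set of heights between 0 and 1.\<close>

abbreviation "slab_map \<tau> \<equiv> (\<lambda>(s, f). (\<tau> * s) *\<^sub>R n + E f)"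

lemma slab_map_measurable: "slab_map \<tau> \<in> borel_measurable (lborel \<Otimes>\<^sub>M \<nu>)"
  by measurable

lemma slab_map_inner: "slab_map \<tau> (s, f) \<bullet> n = \<tau> * s"
  using norm_n by (simp add: inner_simps E_n dot_square_norm)

lemma norm_E_le: "norm (E f) \<le> norm (s *\<^sub>R n + E f)"
proof -
  have "(norm (s *\<^sub>R n + E f))\<^sup>2 = s\<^sup>2 + (norm (E f))\<^sup>2"
    using norm_n E_n[of f] unfolding power2_norm_eq_inner
    by (simp add: inner_simps inner_commute norm_eq_1 power2_eq_square[of s])
  then have "(norm (E f))\<^sup>2 \<le> (norm (s *\<^sub>R n + E f))\<^sup>2" by simp
  then show ?thesis by (rule power2_le_imp_le) simp
qed

text \<open>Formulated as an equality of measures so that it transfers both integrals and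
  almost-everywhere statements; the constant density is the Jacobian of the rescaled height.\<close>

lemma lborel_slice:
  assumes \<tau>: "0 < \<tau>"
  shows "lborel = density (distr (lborel \<Otimes>\<^sub>M \<nu>) borel (slab_map \<tau>)) (\<lambda>_. ennreal \<tau>)"
proof (rule measure_eqI)
  fix A :: "(real^'d) set" assume "A \<in> sets lborel"
  then have A[measurable]: "A \<in> sets borel" by simp
  have "emeasure lborel A = (\<integral>\<^sup>+z. indicator A z \<partial>lborel)" by simp
  also have "\<dots> = (\<integral>\<^sup>+f. \<integral>\<^sup>+s. indicator A (s *\<^sub>R n + E f) \<partial>lborel \<partial>\<nu>)"
    by (rule nn_slice) measurable
  also have "\<dots> = (\<integral>\<^sup>+f. \<integral>\<^sup>+s. ennreal \<tau> * indicator A (slab_map \<tau> (s, f)) \<partial>lborel \<partial>\<nu>)"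
  proof (rule nn_integral_cong)
    fix f assume [measurable]: "f \<in> space \<nu>"
    have "(\<integral>\<^sup>+s. indicator A (s *\<^sub>R n + E f) \<partial>lborel) =
        ennreal \<bar>\<tau>\<bar> * (\<integral>\<^sup>+s. indicator A ((0 + \<tau> * s) *\<^sub>R n + E f) \<partial>lborel)"
      using \<tau> by (intro nn_integral_real_affine) auto
    also have "\<dots> = (\<integral>\<^sup>+s. ennreal \<tau> * indicator A (slab_map \<tau> (s, f)) \<partial>lborel)"
      using \<tau> by (subst nn_integral_cmult[symmetric]) auto
    finally show "(\<integral>\<^sup>+s. indicator A (s *\<^sub>R n + E f) \<partial>lborel) =
      (\<integral>\<^sup>+s. ennreal \<tau> * indicator A (slab_map \<tau> (s, f)) \<partial>lborel)" .
  qed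
  also have "\<dots> = (\<integral>\<^sup>+x. ennreal \<tau> * indicator A (slab_map \<tau> x) \<partial>(lborel \<Otimes>\<^sub>M \<nu>))"
    by (rule P.nn_integral_snd) measurable
  also have "\<dots> = emeasure (density (distr (lborel \<Otimes>\<^sub>M \<nu>) borel (slab_map \<tau>)) (\<lambda>_. ennreal \<tau>)) A"
    by (simp add: emeasure_density nn_integral_distr)
  finally show "emeasure lborel A =
    emeasure (density (distr (lborel \<Otimes>\<^sub>M \<nu>) borel (slab_map \<tau>)) (\<lambda>_. ennreal \<tau>)) A" .
qed simp

lemma integral_slice:
  fixes F :: "real^'d \<Rightarrow> real"
  assumes \<tau>: "0 < \<tau>" and [measurable]: "F \<in> borel_measurable borel"
  shows "integral\<^sup>L lborel F = \<tau> * (\<integral>x. F (slab_map \<tau> x) \<partial>(lborel \<Otimes>\<^sub>M \<nu>))"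
  using \<tau> by (subst lborel_slice[OF \<tau>]) (simp add: integral_density integral_distr)

lemma AE_slice:
  assumes \<tau>: "0 < \<tau>" and "AE z in lborel. R z"
  shows "AE x in lborel \<Otimes>\<^sub>M \<nu>. R (slab_map \<tau> x)"
proof -
  have "AE z in density (distr (lborel \<Otimes>\<^sub>M \<nu>) borel (slab_map \<tau>)) (\<lambda>_. ennreal \<tau>). R z"
    using assms(2) by (subst (asm) lborel_slice[OF \<tau>])
  then have "AE z in distr (lborel \<Otimes>\<^sub>M \<nu>) borel (slab_map \<tau>). R z"
    using \<tau> by (subst (asm) AE_density) auto
  then show ?thesis by (rule AE_distrD[OF slab_map_measurable])
qed

text \<open>Thickening a subset of the hyperplane to a cylinder of finite height reduces questions
  about \<open>\<nu>\<close>, known only through the slicing axioms, to questions about Lebesgue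
  measure on the whole space.\<close>

lemma emeasure_cylinder:
  assumes [measurable]: "J \<in> sets borel" "S \<in> sets borel"
  shows "emeasure lborel {z. z \<bullet> n \<in> J \<and> z - (z \<bullet> n) *\<^sub>R n \<in> S} =
    emeasure lborel J * emeasure \<nu> {f \<in> space \<nu>. E f \<in> S}"
proof -
  have "emeasure lborel {z. z \<bullet> n \<in> J \<and> z - (z \<bullet> n) *\<^sub>R n \<in> S} =
    (\<integral>\<^sup>+z. indicator J (z \<bullet> n) * indicator S (z - (z \<bullet> n) *\<^sub>R n) \<partial>lborel)"
  proof -
    have "(\<integral>\<^sup>+z. indicator J (z \<bullet> n) * indicator S (z - (z \<bullet> n) *\<^sub>R n) \<partial>lborel) =
        (\<integral>\<^sup>+z. indicator {z. z \<bullet> n \<in> J \<and> z - (z \<bullet> n) *\<^sub>R n \<in> S} z \<partial>lborel)"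
      by (intro nn_integral_cong) (simp split: split_indicator)
    also have "\<dots> = emeasure lborel {z. z \<bullet> n \<in> J \<and> z - (z \<bullet> n) *\<^sub>R n \<in> S}"
      by (rule nn_integral_indicator) simp
    finally show ?thesis ..
  qed
  also have "\<dots> = (\<integral>\<^sup>+f. \<integral>\<^sup>+s. indicator J s * indicator S (E f) \<partial>lborel \<partial>\<nu>)"
    using norm_n by (subst nn_slice) (auto simp: inner_simps E_n dot_square_norm)
  also have "\<dots> = (\<integral>\<^sup>+f. emeasure lborel J * indicator {f \<in> space \<nu>. E f \<in> S} f \<partial>\<nu>)"
    by (intro nn_integral_cong) (auto simp: nn_integral_multc split: split_indicator)
  also have "\<dots> = emeasure lborel J * emeasure \<nu> {f \<in> space \<nu>. E f \<in> S}"
    by (subst nn_integral_cmult_indicator) auto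
  finally show ?thesis .
qed

definition "\<omega> = unit_ball_vol (real CARD('d) - 1)"

lemma emeasure_nu_le: "emeasure \<nu> {f \<in> space \<nu>. norm (E f) \<le> 1} = ennreal \<omega>"
  using cball_slice[of 1] by (simp add: \<omega>_def)

lemma \<omega>_pos: "0 < \<omega>"
proof -
  have "1 \<le> CARD('d)" by simp
  then show ?thesis unfolding \<omega>_def by (intro unit_ball_vol_pos) linarith
qed

text \<open>The open disc contains the closed discs of radius \<open>r < 1\<close>, whose measures
  tend to \<omega> as \<open>r\<close> tends to 1.\<close>

lemma measure_nu_ball: "emeasure \<nu> {f \<in> space \<nu>. norm (E f) < 1} = ennreal \<omega>"
proof (rule antisym)
  have "emeasure \<nu> {f \<in> space \<nu>. norm (E f) < 1} \<le> emeasure \<nu> {f \<in> space \<nu>. norm (E f) \<le> 1}"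
    by (intro emeasure_mono) auto
  then show "emeasure \<nu> {f \<in> space \<nu>. norm (E f) < 1} \<le> ennreal \<omega>" by (simp add: emeasure_nu_le)
  have "((\<lambda>r. ennreal (\<omega> * r ^ (CARD('d) - 1))) \<longlongrightarrow> ennreal (\<omega> * 1 ^ (CARD('d) - 1))) (at_left 1)"
    by (intro tendsto_intros)
  moreover have "\<forall>\<^sub>F r in at_left 1. ennreal (\<omega> * r ^ (CARD('d) - 1)) \<le> emeasure \<nu> {f \<in> space \<nu>. norm (E f) < 1}"
  proof (rule eventually_at_leftI[of 0])
    fix r :: real assume r: "r \<in> {0<..<1}"
    have "emeasure \<nu> {f \<in> space \<nu>. norm (E f) \<le> r} \<le> emeasure \<nu> {f \<in> space \<nu>. norm (E f) < 1}"
      using r by (intro emeasure_mono) auto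
    then show "ennreal (\<omega> * r ^ (CARD('d) - 1)) \<le> emeasure \<nu> {f \<in> space \<nu>. norm (E f) < 1}"
      using r by (simp add: cball_slice \<omega>_def)
  qed simp
  ultimately show "ennreal \<omega> \<le> emeasure \<nu> {f \<in> space \<nu>. norm (E f) < 1}"
    using tendsto_upperbound[of _ "ennreal (\<omega> * 1 ^ (CARD('d) - 1))" "at_left (1::real)"] by simp
qed

lemma AE_E_inner_nonzero:
  assumes "\<eta> \<bullet> n = 0" "\<eta> \<noteq> 0"
  shows "AE f in \<nu>. E f \<bullet> \<eta> \<noteq> 0"
proof -
  let ?A = "{z. z \<bullet> n \<in> {0<..<1} \<and> z - (z \<bullet> n) *\<^sub>R n \<in> {y. y \<bullet> \<eta> = 0}}"
  have [measurable]: "?A \<in> sets borel" by measurable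
  have "negligible {z. \<eta> \<bullet> z = 0}" by (rule negligible_hyperplane) (use assms in auto)
  then have "negligible ?A"
    by (rule negligible_subset) (use assms in \<open>auto simp: inner_simps inner_commute\<close>)
  then have "emeasure lborel ?A = 0"
    by (simp add: negligible_iff_null_sets null_sets_def)
  moreover have "emeasure lborel ?A = emeasure lborel {0<..<1::real} * emeasure \<nu> {f \<in> space \<nu>. E f \<in> {y. y \<bullet> \<eta> = 0}}"
    by (rule emeasure_cylinder) measurable
  ultimately have "emeasure \<nu> {f \<in> space \<nu>. E f \<bullet> \<eta> = 0} = 0" by simp
  then show ?thesis by (subst AE_iff_measurable[OF _ refl]) auto
qed

text \<open>The two open half discs are exchanged by the reflection at the origin, and what is left
  between them is null. The abstract parameter space has no reflection of its own, so the symmetry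
  is applied to cylinders in the ambient space; heights in (0,1) become heights in (-1,0).\<close>

lemma measure_nu_half_ball:
  assumes "\<eta> \<bullet> n = 0" "\<eta> \<noteq> 0"
  shows "emeasure \<nu> {f \<in> space \<nu>. norm (E f) < 1 \<and> 0 < E f \<bullet> \<eta>} = ennreal (\<omega> / 2)"
proof -
  define S where "S = {y :: real^'d. norm y < 1 \<and> 0 < y \<bullet> \<eta>}"
  define T where "T = {y :: real^'d. norm y < 1 \<and> y \<bullet> \<eta> < 0}"
  have [measurable]: "S \<in> sets borel" "T \<in> sets borel" unfolding S_def T_def by measurable
  let ?S = "{f \<in> space \<nu>. E f \<in> S}" and ?T = "{f \<in> space \<nu>. E f \<in> T}"
  let ?cS = "{z. z \<bullet> n \<in> {0<..<1} \<and> z - (z \<bullet> n) *\<^sub>R n \<in> S}"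
    and ?cT = "{z. z \<bullet> n \<in> {-1<..<0} \<and> z - (z \<bullet> n) *\<^sub>R n \<in> T}"
  have "emeasure \<nu> ?S = emeasure lborel ?cS"
    by (subst emeasure_cylinder) auto
  also have "\<dots> = emeasure (distr lborel borel uminus) ?cS"
    using lborel_affine[of "-1" "0::real^'d"] by (simp add: density_1)
  also have "\<dots> = emeasure lborel ?cT"
  proof -
    have "uminus -` ?cS = ?cT"
    proof (rule set_eqI)
      fix z
      define y where "y = z - (z \<bullet> n) *\<^sub>R n"
      have "- z - ((- z) \<bullet> n) *\<^sub>R n = - y" by (simp add: y_def)
      then show "z \<in> uminus -` ?cS \<longleftrightarrow> z \<in> ?cT"
        unfolding vimage_eq mem_Collect_eq y_def[symmetric] by (auto simp: S_def T_def)
    qed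
    moreover have "?cS \<in> sets borel" by measurable
    ultimately show ?thesis by (subst emeasure_distr) auto
  qed
  also have "\<dots> = emeasure \<nu> ?T" by (subst emeasure_cylinder) auto
  finally have eq: "emeasure \<nu> ?S = emeasure \<nu> ?T" .
  have "ennreal \<omega> = emeasure \<nu> (?S \<union> ?T)"
    unfolding measure_nu_ball[symmetric]
  proof (rule emeasure_eq_AE)
    show "AE f in \<nu>. f \<in> {f \<in> space \<nu>. norm (E f) < 1} \<longleftrightarrow> f \<in> ?S \<union> ?T"
      using AE_E_inner_nonzero[OF assms] by eventually_elim (auto simp: S_def T_def)
  qed measurable
  also have "\<dots> = emeasure \<nu> ?S + emeasure \<nu> ?T"
    by (rule plus_emeasure[symmetric]) (auto simp: S_def T_def)
  finally have 2: "emeasure \<nu> ?S + emeasure \<nu> ?S = ennreal \<omega>" by (simp add: eq)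
  have "emeasure \<nu> ?S \<noteq> top"
  proof
    assume "emeasure \<nu> ?S = top"
    then show False using 2 by simp
  qed
  then obtain x where x: "0 \<le> x" "emeasure \<nu> ?S = ennreal x" by (cases "emeasure \<nu> ?S") auto
  then have "x + x = \<omega>" using 2 \<omega>_pos by (simp add: ennreal_plus[symmetric] del: ennreal_plus)
  then have "emeasure \<nu> ?S = ennreal (\<omega> / 2)" using x by simp
  then show ?thesis by (simp add: S_def)
qed

end

section \<open>The divergence theorem on a half space\<close>

context slicing
begin

lemma integrable_slab:
  fixes a b :: real
  shows "integrable (lborel \<Otimes>\<^sub>M \<nu>) (\<lambda>(s, f). indicator {a..b} s * indicator {f \<in> space \<nu>. norm (E f) \<le> 1} f :: real)"
proof (cases "a \<le> b")
  case True
  let ?A = "{a..b} \<times> {f \<in> space \<nu>. norm (E f) \<le> 1}"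
  have "emeasure (lborel \<Otimes>\<^sub>M \<nu>) ?A = ennreal (b - a) * ennreal \<omega>"
    using True by (subst emeasure_pair_measure_Times) (auto simp: emeasure_nu_le)
  also have "\<dots> < \<infinity>" by (simp add: ennreal_mult[symmetric] ennreal_mult_less_top)
  finally have "integrable (lborel \<Otimes>\<^sub>M \<nu>) (indicator ?A :: _ \<Rightarrow> real)"
    by (intro integrable_real_indicator) auto
  then show ?thesis
    by (rule Bochner_Integration.integrable_cong[OF refl, THEN iffD1, rotated])
       (auto simp: indicator_def)
qed (simp add: case_prod_unfold)

text \<open>Integrating the difference quotient of \<open>g\<close> in direction \<open>q\<close> over the half space and shifting
  the half space instead of \<open>g\<close> yields the divergence theorem for the Lipschitz function \<open>g\<close>.\<close>
lemma half_space_gradient_integral: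
  fixes g :: "real^'d \<Rightarrow> real"
  assumes lip: "K-lipschitz_on UNIV g"
    and supp: "\<And>z. 1 \<le> norm z \<Longrightarrow> g z = 0"
    and der: "AE z in lborel. (g has_derivative (\<lambda>x. v z \<bullet> x)) (at z)"
    and v[measurable]: "v \<in> borel_measurable borel"
  shows "(\<integral>z. indicator {z. 0 < z \<bullet> n} z * (q \<bullet> v z) \<partial>lborel) = - (q \<bullet> n) * (\<integral>f. g (E f) \<partial>\<nu>)"
proof -
  define H where "H = {z :: real^'d. 0 < z \<bullet> n}"
  have [measurable]: "H \<in> sets borel" unfolding H_def by measurable
  have K: "\<bar>g x - g y\<bar> \<le> K * norm (x - y)" for x y
    using lipschitz_onD[OF lip, of x y] by (simp add: dist_norm)
  have K0: "0 \<le> K" using lip by (rule lipschitz_on_nonneg)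
  have contg: "continuous_on UNIV g" using lip by (rule lipschitz_on_continuous_on)
  then have g[measurable]: "g \<in> borel_measurable borel" by (rule borel_measurable_continuous_onI)
  \<comment> \<open>Compare \<open>z\<close> with its radial projection onto the unit sphere, where
    \<open>g\<close> vanishes, at distance at most 1; for \<open>z = 0\<close> any unit vector
    serves.\<close>
  have bnd: "\<bar>g z\<bar> \<le> K * indicator (cball 0 1) z" for z
  proof (cases "norm z \<le> 1")
    case True
    show ?thesis
    proof (cases "z = 0")
      case True
      obtain u :: "real^'d" where "norm u = 1" using norm_n by blast
      then show ?thesis using K[of 0 u] supp[of u] True by simp
    next
      case False
      define u where "u = z /\<^sub>R norm z"
      have u: "norm u = 1" using False by (simp add: u_def)
      have "norm (z - u) = 1 - norm z"
      proof -
        have "z - u = (norm z - 1) *\<^sub>R u" using False by (simp add: u_def algebra_simps)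
        then show ?thesis using u True by simp
      qed
      then have "K * norm (z - u) \<le> K" using K0 by (simp add: mult_left_le)
      then show ?thesis using K[of z u] supp[of u] u True by simp
    qed
  qed (simp add: supp)
  have integrable_cball: "integrable lborel (indicator (cball 0 R :: (real^'d) set) :: _ \<Rightarrow> real)" for R
    using emeasure_lborel_cball_finite[of "0::real^'d" R] by (intro integrable_real_indicator) auto
  define D where "D k z = indicator H z * (real (Suc k) * (g (z + q /\<^sub>R real (Suc k)) - g z))" for k z
  have lim1: "(\<lambda>k. integral\<^sup>L lborel (D k)) \<longlonglongrightarrow> (\<integral>z. indicator H z * (q \<bullet> v z) \<partial>lborel)"
  proof (rule integral_dominated_convergence)
    show "AE z in lborel. (\<lambda>k. D k z) \<longlonglongrightarrow> indicator H z * (q \<bullet> v z)"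
      using der
    proof eventually_elim
      case (elim z)
      have "(\<lambda>k. (g (z + inverse (real (Suc k)) *\<^sub>R q) - g z) / inverse (real (Suc k))) \<longlonglongrightarrow> v z \<bullet> q"
        by (rule difference_quotient_LIMSEQ[OF elim])
      then have "(\<lambda>k. indicator H z * ((g (z + inverse (real (Suc k)) *\<^sub>R q) - g z) / inverse (real (Suc k))))
          \<longlonglongrightarrow> indicator H z * (v z \<bullet> q)"
        by (intro tendsto_intros)
      then show ?case by (simp add: D_def[abs_def] divide_inverse inner_commute mult.commute)
    qed
    \<comment> \<open>The shift has norm at most \<open>norm q\<close>, so every difference quotient
      is supported in the ball of radius \<open>1 + norm q\<close>, and the Lipschitz condition
      bounds it by \<open>K * norm q\<close>.\<close>
    show "integrable lborel (\<lambda>z :: real^'d. (K * norm q) * indicator (cball 0 (1 + norm q)) z)"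
      by (rule integrable_mult_right) (rule integrable_cball)
    show "AE z in lborel. norm (D k z) \<le> (K * norm q) * indicator (cball 0 (1 + norm q)) z" for k
    proof (rule AE_I2)
      fix z
      let ?c = "real (Suc k)"
      have c: "1 \<le> ?c" by simp
      show "norm (D k z) \<le> (K * norm q) * indicator (cball 0 (1 + norm q)) z"
      proof (cases "norm z \<le> 1 + norm q")
        case True
        have "\<bar>g (z + q /\<^sub>R ?c) - g z\<bar> \<le> K * norm (q /\<^sub>R ?c)" using K[of "z + q /\<^sub>R ?c" z] by simp
        then have "?c * \<bar>g (z + q /\<^sub>R ?c) - g z\<bar> \<le> ?c * (K * norm (q /\<^sub>R ?c))"
          by (intro mult_left_mono) auto
        also have "\<dots> = K * norm q" by (simp add: field_simps)
        finally show ?thesis using True K0 by (auto simp: D_def abs_mult split: split_indicator)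
      next
        case False
        have "norm (q /\<^sub>R ?c) \<le> norm q"
          using c by (simp add: divide_inverse mult_left_le_one_le inverse_le_1_iff)
        moreover have "norm z \<le> norm (z + q /\<^sub>R ?c) + norm (q /\<^sub>R ?c)"
          using norm_triangle_sub[of z "z + q /\<^sub>R ?c"] by (simp add: norm_minus_commute)
        ultimately have "1 \<le> norm (z + q /\<^sub>R ?c)" "1 \<le> norm z" using False norm_ge_zero[of q] by linarith+
        then show ?thesis using False by (simp add: D_def supp)
      qed
    qed
  qed (auto simp: D_def[abs_def])
  \<comment> \<open>In heights rescaled by \<open>1 / m\<close>, shifting the half space by
    \<open>q / m\<close> moves its boundary from height 0 to height \<open>c\<close>, independently
    of \<open>m\<close>, while the factor \<open>m\<close> of the difference quotient cancels the
    Jacobian. The signed indicator \<open>a\<close> of the slab between both boundaries remains; its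
    integral is \<open>- c\<close> for either sign of \<open>c\<close>.\<close>
  define c where "c = q \<bullet> n"
  define a where "a s = (indicator {c<..} s - indicator {0<..} s :: real)" for s
  have [measurable]: "a \<in> borel_measurable borel" unfolding a_def by measurable
  have a_abs: "\<bar>a s\<bar> \<le> indicator {- \<bar>c\<bar>..\<bar>c\<bar>} s" for s
    by (auto simp: a_def split: split_indicator)
  have D_int: "integral\<^sup>L lborel (D k) = (\<integral>x. a (fst x) * g (slab_map (1 / real (Suc k)) x) \<partial>(lborel \<Otimes>\<^sub>M \<nu>))" for k
  proof -
    define m where "m = real (Suc k)"
    have m: "0 < m" by (simp add: m_def)
    have ig: "integrable lborel (\<lambda>z. indicator A z * g z)" if [measurable]: "A \<in> sets borel" for A :: "(real^'d) set"
    proof (rule Bochner_Integration.integrable_bound)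
      show "integrable lborel (\<lambda>z. K * indicator (cball 0 1 :: (real^'d) set) z)"
        by (rule integrable_mult_right) (rule integrable_cball)
      show "AE z in lborel. norm (indicator A z * g z) \<le> norm (K * indicator (cball 0 1) z)"
      proof (rule AE_I2)
        fix z
        show "norm (indicator A z * g z) \<le> norm (K * indicator (cball 0 1) z)"
          using bnd[of z] K0 by (auto simp: abs_mult indicator_def split: if_splits)
      qed
    qed measurable
    let ?A = "{z. z - q /\<^sub>R m \<in> H}"
    have [measurable]: "?A \<in> sets borel" by measurable
    have "lborel = distr lborel borel (\<lambda>z. q /\<^sub>R m + z)" by (simp add: lborel_distr_plus)
    then have shift: "integrable lborel (\<lambda>z. indicator H z * g (z + q /\<^sub>R m))"
      "(\<integral>z. indicator H z * g (z + q /\<^sub>R m) \<partial>lborel) = (\<integral>z. indicator ?A z * g z \<partial>lborel)"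
    proof -
      have e: "indicator H z * g (z + q /\<^sub>R m) = indicator ?A (q /\<^sub>R m + z) * g (q /\<^sub>R m + z)" for z
        by (simp add: indicator_def add.commute)
      have "integrable (distr lborel borel (\<lambda>z. q /\<^sub>R m + z)) (\<lambda>z. indicator ?A z * g z)"
        unfolding lborel_distr_plus by (rule ig) measurable
      then show "integrable lborel (\<lambda>z. indicator H z * g (z + q /\<^sub>R m))"
        unfolding e by (subst (asm) integrable_distr_eq) auto
      have "(\<integral>z. indicator ?A z * g z \<partial>lborel) = (\<integral>z. indicator ?A z * g z \<partial>distr lborel borel (\<lambda>z. q /\<^sub>R m + z))"
        by (simp add: lborel_distr_plus)
      also have "\<dots> = (\<integral>z. indicator ?A (q /\<^sub>R m + z) * g (q /\<^sub>R m + z) \<partial>lborel)"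
        by (rule integral_distr) auto
      finally show "(\<integral>z. indicator H z * g (z + q /\<^sub>R m) \<partial>lborel) = (\<integral>z. indicator ?A z * g z \<partial>lborel)"
        by (simp add: e)
    qed
    have "integral\<^sup>L lborel (D k) = (\<integral>z. m * (indicator H z * g (z + q /\<^sub>R m) - indicator H z * g z) \<partial>lborel)"
      by (simp add: D_def[abs_def] m_def algebra_simps)
    also have "\<dots> = m * ((\<integral>z. indicator ?A z * g z \<partial>lborel) - (\<integral>z. indicator H z * g z \<partial>lborel))"
      using shift ig[of H] by simp
    also have "\<dots> = m * (\<integral>z. indicator ?A z * g z - indicator H z * g z \<partial>lborel)"
      using ig[of ?A] ig[of H] by simp
    also have "\<dots> = m * ((1 / m) * (\<integral>x. indicator ?A (slab_map (1 / m) x) * g (slab_map (1 / m) x)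
        - indicator H (slab_map (1 / m) x) * g (slab_map (1 / m) x) \<partial>(lborel \<Otimes>\<^sub>M \<nu>)))"
      using m by (subst integral_slice[of "1 / m"]) auto
    also have "\<dots> = (\<integral>x. a (fst x) * g (slab_map (1 / m) x) \<partial>(lborel \<Otimes>\<^sub>M \<nu>))"
    proof -
      have "indicator ?A (slab_map (1 / m) x) * g (slab_map (1 / m) x) - indicator H (slab_map (1 / m) x) * g (slab_map (1 / m) x)
        = a (fst x) * g (slab_map (1 / m) x)" for x
      proof (cases x)
        case (Pair s f)
        have "(slab_map (1 / m) (s, f) - q /\<^sub>R m) \<bullet> n = (s - c) / m"
          using slab_map_inner[of "1 / m" s f] by (simp add: inner_diff_left c_def divide_inverse left_diff_distrib right_diff_distrib mult.commute)
        then have "slab_map (1 / m) (s, f) \<in> ?A \<longleftrightarrow> c < s"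
          using m by (simp add: H_def zero_less_divide_iff)
        moreover have "slab_map (1 / m) (s, f) \<in> H \<longleftrightarrow> 0 < s"
          using m slab_map_inner[of "1 / m" s f] by (simp add: H_def zero_less_divide_iff)
        ultimately show ?thesis
          by (simp add: Pair a_def indicator_def del: split_paired_All)
      qed
      then show ?thesis using m by simp
    qed
    finally show ?thesis by (simp add: m_def)
  qed
  have gE: "integrable \<nu> (\<lambda>f. g (E f))"
  proof (rule Bochner_Integration.integrable_bound)
    show "integrable \<nu> (\<lambda>f. K * indicator {f \<in> space \<nu>. norm (E f) \<le> 1} f)"
      by (intro integrable_mult_right integrable_real_indicator) (auto simp: emeasure_nu_le)
    show "AE f in \<nu>. norm (g (E f)) \<le> norm (K * indicator {f \<in> space \<nu>. norm (E f) \<le> 1} f)"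
    proof (rule AE_I2)
      fix f assume "f \<in> space \<nu>"
      then show "norm (g (E f)) \<le> norm (K * indicator {f \<in> space \<nu>. norm (E f) \<le> 1} f)"
        using bnd[of "E f"] K0 by (auto simp: abs_mult indicator_def split: if_splits)
    qed
  qed measurable
  have dom: "norm (a (fst x) * g (slab_map \<tau> x)) \<le>
      K * (case x of (s, f) \<Rightarrow> indicator {- \<bar>c\<bar>..\<bar>c\<bar>} s * indicator {f \<in> space \<nu>. norm (E f) \<le> 1} f)"
    if "x \<in> space (lborel \<Otimes>\<^sub>M \<nu>)" for x \<tau>
  proof (cases x)
    case (Pair s f)
    then have f: "f \<in> space \<nu>" using that by (simp add: space_pair_measure)
    have "indicator (cball 0 1) ((\<tau> * s) *\<^sub>R n + E f) \<le> (indicator {f \<in> space \<nu>. norm (E f) \<le> 1} f :: real)"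
      using norm_E_le[of f "\<tau> * s"] f by (auto simp: indicator_def)
    from mult_left_mono[OF this K0]
    have "\<bar>g ((\<tau> * s) *\<^sub>R n + E f)\<bar> \<le> K * indicator {f \<in> space \<nu>. norm (E f) \<le> 1} f"
      using bnd[of "(\<tau> * s) *\<^sub>R n + E f"] by linarith
    then have "\<bar>a s\<bar> * \<bar>g ((\<tau> * s) *\<^sub>R n + E f)\<bar> \<le>
      indicator {- \<bar>c\<bar>..\<bar>c\<bar>} s * (K * indicator {f \<in> space \<nu>. norm (E f) \<le> 1} f)"
      by (intro mult_mono a_abs) auto
    then show ?thesis by (simp add: Pair abs_mult mult_ac)
  qed
  have dom_int: "integrable (lborel \<Otimes>\<^sub>M \<nu>)
    (\<lambda>x. K * (case x of (s, f) \<Rightarrow> indicator {- \<bar>c\<bar>..\<bar>c\<bar>} s * indicator {f \<in> space \<nu>. norm (E f) \<le> 1} f))"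
    by (intro integrable_mult_right integrable_slab)
  have lim2: "(\<lambda>k. integral\<^sup>L lborel (D k)) \<longlonglongrightarrow> (\<integral>x. a (fst x) * g (E (snd x)) \<partial>(lborel \<Otimes>\<^sub>M \<nu>))"
    unfolding D_int
  proof (rule integral_dominated_convergence[OF _ _ dom_int])
    show "AE x in lborel \<Otimes>\<^sub>M \<nu>. (\<lambda>k. a (fst x) * g (slab_map (1 / real (Suc k)) x)) \<longlonglongrightarrow> a (fst x) * g (E (snd x))"
    proof (rule AE_I2)
      fix x :: "real \<times> 'i"
      obtain s f where x: "x = (s, f)" by (cases x)
      have "(\<lambda>k. (1 / real (Suc k) * s) *\<^sub>R n + E f) \<longlonglongrightarrow> (0 * s) *\<^sub>R n + E f"
        by (intro tendsto_intros) (use LIMSEQ_inverse_real_of_nat in \<open>simp add: inverse_eq_divide\<close>)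
      then have "(\<lambda>k. (1 / real (Suc k) * s) *\<^sub>R n + E f) \<longlonglongrightarrow> E f" by simp
      then have "(\<lambda>k. g ((1 / real (Suc k) * s) *\<^sub>R n + E f)) \<longlonglongrightarrow> g (E f)"
        by (rule continuous_on_tendsto_compose[OF contg]) auto
      then show "(\<lambda>k. a (fst x) * g (slab_map (1 / real (Suc k)) x)) \<longlonglongrightarrow> a (fst x) * g (E (snd x))"
        unfolding x by (auto intro!: tendsto_mult)
    qed
    show "AE x in lborel \<Otimes>\<^sub>M \<nu>. norm (a (fst x) * g (slab_map (1 / real (Suc k)) x)) \<le>
      K * (case x of (s, f) \<Rightarrow> indicator {- \<bar>c\<bar>..\<bar>c\<bar>} s * indicator {f \<in> space \<nu>. norm (E f) \<le> 1} f)" for k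
      by (rule AE_I2) (rule dom)
  qed measurable
  have "integrable (lborel \<Otimes>\<^sub>M \<nu>) (\<lambda>x. a (fst x) * g (E (snd x)))"
  proof (rule Bochner_Integration.integrable_bound[OF dom_int])
    show "AE x in lborel \<Otimes>\<^sub>M \<nu>. norm (a (fst x) * g (E (snd x))) \<le> norm
      (K * (case x of (s, f) \<Rightarrow> indicator {- \<bar>c\<bar>..\<bar>c\<bar>} s * indicator {f \<in> space \<nu>. norm (E f) \<le> 1} f))"
    proof (rule AE_I2)
      fix x :: "real \<times> 'i" assume x: "x \<in> space (lborel \<Otimes>\<^sub>M \<nu>)"
      show "norm (a (fst x) * g (E (snd x))) \<le> norm
      (K * (case x of (s, f) \<Rightarrow> indicator {- \<bar>c\<bar>..\<bar>c\<bar>} s * indicator {f \<in> space \<nu>. norm (E f) \<le> 1} f))"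
        using dom[OF x, of 0] K0 by (cases x) (simp add: abs_mult)
    qed
  qed measurable
  then have "(\<integral>x. a (fst x) * g (E (snd x)) \<partial>(lborel \<Otimes>\<^sub>M \<nu>)) = (\<integral>s. (\<integral>f. a s * g (E f) \<partial>\<nu>) \<partial>lborel)"
    using P.integral_fst[of "\<lambda>s f. a s * g (E f)"] by (simp add: case_prod_beta')
  also have "\<dots> = (\<integral>s. a s \<partial>lborel) * (\<integral>f. g (E f) \<partial>\<nu>)" using gE by simp
  also have "(\<integral>s. a s \<partial>lborel) = - c"
  proof (cases "0 \<le> c")
    case True
    have "a = (\<lambda>s. - indicator {0<..c} s)" using True by (auto simp: a_def fun_eq_iff split: split_indicator)
    then show ?thesis using True by simp
  next
    case False
    have "a = (\<lambda>s. indicator {c<..0} s)" using False by (auto simp: a_def fun_eq_iff split: split_indicator)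
    then show ?thesis using False by simp
  qed
  finally have "(\<integral>x. a (fst x) * g (E (snd x)) \<partial>(lborel \<Otimes>\<^sub>M \<nu>)) = - (q \<bullet> n) * (\<integral>f. g (E f) \<partial>\<nu>)"
    by (simp add: c_def)
  with LIMSEQ_unique[OF lim1 lim2] show ?thesis by (simp add: H_def)
qed

end

section \<open>The scalar profile of the variation\<close>

text \<open>Defined through difference quotients so that it is Borel measurable everywhere; it is the gradient
  only where \<open>g\<close> is differentiable.\<close>
definition gradient_of :: "('a::euclidean_space \<Rightarrow> real) \<Rightarrow> 'a \<Rightarrow> 'a" where
  "gradient_of g x = (\<Sum>b\<in>Basis. lim (\<lambda>k. (g (x + inverse (real (Suc k)) *\<^sub>R b) - g x) / inverse (real (Suc k))) *\<^sub>R b)"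

lemma borel_measurable_gradient_of:
  assumes "continuous_on UNIV g"
  shows "gradient_of g \<in> borel_measurable borel"
proof -
  have [measurable]: "g \<in> borel_measurable borel" using assms by (rule borel_measurable_continuous_onI)
  show ?thesis unfolding gradient_of_def
    by (intro borel_measurable_sum borel_measurable_scaleR borel_measurable_lim_metric) auto
qed

lemma gradient_of_eqI:
  assumes "(g has_derivative (\<lambda>w. u \<bullet> w)) (at x)"
  shows "gradient_of g x = u"
proof -
  have "lim (\<lambda>k. (g (x + inverse (real (Suc k)) *\<^sub>R b) - g x) / inverse (real (Suc k))) = u \<bullet> b" for b
    by (rule limI) (rule difference_quotient_LIMSEQ[OF assms])
  then show ?thesis by (simp add: gradient_of_def euclidean_representation)
qed

lemma has_derivative_gradient_of:
  assumes "g differentiable (at x)"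
  shows "(g has_derivative (\<lambda>w. gradient_of g x \<bullet> w)) (at x)"
proof -
  obtain D where D: "(g has_derivative D) (at x)" using assms by (auto simp: differentiable_def)
  interpret D: bounded_linear D using D by (rule has_derivative_bounded_linear)
  define u where "u = (\<Sum>b\<in>Basis. D b *\<^sub>R b)"
  have "D w = u \<bullet> w" for w
  proof -
    have "D w = D (\<Sum>b\<in>Basis. (w \<bullet> b) *\<^sub>R b)" by (simp add: euclidean_representation)
    also have "\<dots> = u \<bullet> w" by (simp add: D.sum D.scaleR u_def inner_sum_left inner_commute[of w] mult.commute)
    finally show ?thesis .
  qed
  then have "D = (\<lambda>w. u \<bullet> w)" by (rule ext)
  with D have "(g has_derivative (\<lambda>w. u \<bullet> w)) (at x)" by simp
  then show ?thesis using gradient_of_eqI by metis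
qed

text \<open>Differentiating in the direction of the gradient \<open>u\<close> itself gives
  \<open>u \<bullet> u \<le> K * norm u\<close>. The bound is asked for on an open set only, because
  outside the layer \<open>g\<close> has a much smaller Lipschitz constant than globally.\<close>

lemma norm_gradient_of_le:
  assumes "g differentiable (at x)" "open S" "x \<in> S" "0 \<le> K"
    and lip: "\<And>y. y \<in> S \<Longrightarrow> \<bar>g y - g x\<bar> \<le> K * norm (y - x)"
  shows "norm (gradient_of g x) \<le> K"
proof -
  define u where "u = gradient_of g x"
  have "((\<lambda>t. g (x + t *\<^sub>R u)) has_real_derivative (u \<bullet> u)) (at 0)"
    unfolding u_def by (rule has_real_derivative_along_line[OF has_derivative_gradient_of[OF assms(1)]])
  then have lim: "((\<lambda>t. (g (x + t *\<^sub>R u) - g x) / t) \<longlongrightarrow> u \<bullet> u) (at_right 0)"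
    by (simp add: DERIV_def filterlim_at_split)
  have "((\<lambda>t. x + t *\<^sub>R u) \<longlongrightarrow> x + 0 *\<^sub>R u) (at_right 0)" by (intro tendsto_intros)
  then have "\<forall>\<^sub>F t in at_right 0. x + t *\<^sub>R u \<in> S"
    using assms(2,3) by (intro topological_tendstoD) auto
  moreover have "\<forall>\<^sub>F t :: real in at_right 0. 0 < t" by (simp add: eventually_at_right_less)
  ultimately have "\<forall>\<^sub>F t in at_right 0. (g (x + t *\<^sub>R u) - g x) / t \<le> K * norm u"
  proof eventually_elim
    case (elim t)
    have "g (x + t *\<^sub>R u) - g x \<le> K * norm u * t"
      using lip[OF elim(1)] elim(2) by (simp add: mult_ac abs_le_iff)
    then show ?case using elim(2) by (simp add: divide_le_eq)
  qed
  then have "u \<bullet> u \<le> K * norm u" by (intro tendsto_upperbound[OF lim]) auto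
  then have "norm u * norm u \<le> K * norm u" by (simp add: power2_norm_eq_inner[symmetric] power2_eq_square)
  then show ?thesis using assms(4) unfolding u_def by (cases "gradient_of g x = 0") auto
qed

lemma phi_range: "0 \<le> phi s" "phi s \<le> 1"
  by (auto simp: phi_def)

lemma phi_lipschitz: "\<bar>phi s - phi t\<bar> \<le> \<bar>s - t\<bar>"
  by (auto simp: phi_def)

lemma phi_differentiable:
  assumes "t \<noteq> 0" "t \<noteq> 1"
  shows "phi differentiable (at t)"
proof -
  consider "t < 0" | "0 < t" "t < 1" | "1 < t" using assms by linarith
  then show ?thesis
  proof cases
    case 1
    have "(phi has_derivative (\<lambda>_. 0)) (at t)"
      by (rule has_derivative_transform_within_open[where f = "\<lambda>_. 1" and s = "{..<0}"]) (use 1 in \<open>auto simp: phi_def\<close>)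
    then show ?thesis by (rule differentiableI)
  next
    case 2
    have "((\<lambda>s. 1 - s) has_derivative (\<lambda>x. - x)) (at t)" by (auto intro!: derivative_eq_intros)
    then have "(phi has_derivative (\<lambda>x. - x)) (at t)"
      by (rule has_derivative_transform_within_open[where s = "{0<..<1}"]) (use 2 in \<open>auto simp: phi_def\<close>)
    then show ?thesis by (rule differentiableI)
  next
    case 3
    have "(phi has_derivative (\<lambda>_. 0)) (at t)"
      by (rule has_derivative_transform_within_open[where f = "\<lambda>_. 0" and s = "{1<..}"]) (use 3 in \<open>auto simp: phi_def\<close>)
    then show ?thesis by (rule differentiableI)
  qed
qed

lemma product_lipschitz:
  fixes f g :: "'a::real_normed_vector \<Rightarrow> real"
  assumes "\<bar>f x - f y\<bar> \<le> A * norm (x - y)" "\<bar>g x - g y\<bar> \<le> B * norm (x - y)"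
    and "\<bar>f y\<bar> \<le> F" "\<bar>g x\<bar> \<le> G" "0 \<le> F" "0 \<le> G"
  shows "\<bar>f x * g x - f y * g y\<bar> \<le> (A * G + F * B) * norm (x - y)"
proof -
  have "f x * g x - f y * g y = (f x - f y) * g x + f y * (g x - g y)" by (simp add: algebra_simps)
  then have "\<bar>f x * g x - f y * g y\<bar> \<le> \<bar>f x - f y\<bar> * \<bar>g x\<bar> + \<bar>f y\<bar> * \<bar>g x - g y\<bar>"
    by (simp add: abs_mult[symmetric])
  also have "\<dots> \<le> (A * norm (x - y)) * G + F * (B * norm (x - y))"
    using assms by (intro add_mono mult_mono) auto
  finally show ?thesis by (simp add: algebra_simps)
qed

text \<open>A single value of \<open>h\<close> is fixed, and \<open>\<zeta>\<close> stands for the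
  member of the cut-off family that belongs to it.\<close>

locale interchange_profile =
  fixes n \<eta> :: "real^'d" and h C L :: real and \<zeta> \<rho> :: "real \<Rightarrow> real"
  assumes n_unit: "norm n = 1" and eta_unit: "norm \<eta> = 1" and eta_perp: "\<eta> \<bullet> n = 0"
    and h_pos: "0 < h" and h_less: "h < 1"
    and zeta_lip: "(C / sqrt h)-lipschitz_on {0..} \<zeta>"
    and zeta_one: "\<And>t. 0 \<le> t \<Longrightarrow> t \<le> 1 - sqrt h \<Longrightarrow> \<zeta> t = 1"
    and zeta_zero: "\<And>t. 1 \<le> t \<Longrightarrow> \<zeta> t = 0"
    and rho_lip: "L-lipschitz_on UNIV \<rho>"
    and rho_one: "\<And>t. 1 < t \<Longrightarrow> \<rho> t = 1"
    and rho_zero: "\<And>t. t < 0 \<Longrightarrow> \<rho> t = 0"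
begin

text \<open>\<open>p\<close> is the coefficient of \<open>a\<close> in \<open>Phi_plus\<close>, and
  its reflection the one in \<open>Phi_minus\<close>. \<open>T\<close> collects the factors with
  derivative of order \<open>1 / sqrt h\<close>, as opposed to the layer profile
  \<open>phi (x \<bullet> n / h)\<close> with derivative of order \<open>1 / h\<close>.\<close>

definition "T x = \<rho> (x \<bullet> \<eta> / sqrt h) * \<zeta> (norm x)"
definition "p x = h * phi (x \<bullet> n / h) * T x"
definition "g x = p x + p (- x)"
text \<open>These constants depend on \<open>L\<close> and \<open>C\<close> only, hence are uniform
  in \<open>h\<close>. No range is prescribed for the cut-offs, so \<open>R\<close> and
  \<open>Z\<close> bound \<open>\<rho>\<close> and \<open>\<zeta>\<close> through their Lipschitz
  constants, starting from the values \<open>\<rho> 2 = 1\<close> and \<open>\<zeta> 1 = 0\<close>.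
  \<open>M / sqrt h\<close> is a Lipschitz constant of \<open>T\<close>, and \<open>K\<close> is one
  of \<open>g\<close>.\<close>

definition "R = 1 + 2 * L"
definition "Z = 1 + C"
definition "M = L * Z + R * C"
definition "K = 2 * (R * Z + M)"

lemma sqrt_h: "0 < sqrt h" "sqrt h < 1" "sqrt h * sqrt h = h" "h \<le> sqrt h"
proof -
  show 1: "0 < sqrt h" "sqrt h < 1" "sqrt h * sqrt h = h" using h_pos h_less by auto
  have "sqrt h * sqrt h \<le> sqrt h * 1" using 1 by (intro mult_left_mono) auto
  then show "h \<le> sqrt h" using 1 by simp
qed

lemma L_nonneg: "0 \<le> L" using rho_lip by (rule lipschitz_on_nonneg)

lemma C_nonneg: "0 \<le> C"
  using lipschitz_on_nonneg[OF zeta_lip] sqrt_h by (simp add: zero_le_divide_iff)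

lemma constants_nonneg: "0 \<le> R" "0 \<le> Z" "0 \<le> M" "0 \<le> K"
  using L_nonneg C_nonneg by (simp_all add: R_def Z_def M_def K_def)

lemma rho_lipD: "\<bar>\<rho> s - \<rho> t\<bar> \<le> L * \<bar>s - t\<bar>"
  using lipschitz_onD[OF rho_lip, of s t] by (simp add: dist_real_def)

lemma zeta_lipD: "0 \<le> s \<Longrightarrow> 0 \<le> t \<Longrightarrow> \<bar>\<zeta> s - \<zeta> t\<bar> \<le> C / sqrt h * \<bar>s - t\<bar>"
  using lipschitz_onD[OF zeta_lip, of s t] by (simp add: dist_real_def)

lemma rho_bound: "\<bar>\<rho> t\<bar> \<le> R"
proof -
  consider "t < 0" | "1 < t" | "0 \<le> t" "t \<le> 1" by linarith
  then show ?thesis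
  proof cases
    case 3
    then have "L * \<bar>t - 2\<bar> \<le> L * 2" by (intro mult_left_mono L_nonneg) auto
    then show ?thesis using rho_lipD[of t 2] rho_one[of 2] by (simp add: R_def)
  qed (use L_nonneg in \<open>auto simp: rho_zero rho_one R_def\<close>)
qed

lemma zeta_bound:
  assumes "0 \<le> t" shows "\<bar>\<zeta> t\<bar> \<le> Z"
proof -
  consider "t \<le> 1 - sqrt h" | "1 \<le> t" | "1 - sqrt h \<le> t" "t \<le> 1" by linarith
  then show ?thesis
  proof cases
    case 3
    have "C / sqrt h * \<bar>t - 1\<bar> \<le> C / sqrt h * sqrt h"
      using 3 C_nonneg sqrt_h by (intro mult_left_mono) auto
    then show ?thesis using zeta_lipD[of t 1] zeta_zero[of 1] assms sqrt_h by (simp add: Z_def)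
  qed (use C_nonneg assms in \<open>auto simp: zeta_zero zeta_one Z_def\<close>)
qed

lemma T_bound: "\<bar>T x\<bar> \<le> R * Z"
  unfolding T_def abs_mult by (intro mult_mono rho_bound zeta_bound) (auto simp: constants_nonneg)

lemma T_lip: "\<bar>T x - T y\<bar> \<le> M / sqrt h * norm (x - y)"
proof -
  have "\<bar>T x - T y\<bar> \<le> (L / sqrt h * Z + R * (C / sqrt h)) * norm (x - y)"
    unfolding T_def
  proof (rule product_lipschitz)
    have "\<bar>x \<bullet> \<eta> / sqrt h - y \<bullet> \<eta> / sqrt h\<bar> = \<bar>(x - y) \<bullet> \<eta>\<bar> / sqrt h"
      using sqrt_h by (simp add: inner_diff_left diff_divide_distrib[symmetric] abs_divide)
    also have "\<dots> \<le> norm (x - y) / sqrt h"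
      using Cauchy_Schwarz_ineq2[of "x - y" \<eta>] sqrt_h eta_unit by (intro divide_right_mono) auto
    finally have "L * \<bar>x \<bullet> \<eta> / sqrt h - y \<bullet> \<eta> / sqrt h\<bar> \<le> L * (norm (x - y) / sqrt h)"
      by (intro mult_left_mono L_nonneg)
    then show "\<bar>\<rho> (x \<bullet> \<eta> / sqrt h) - \<rho> (y \<bullet> \<eta> / sqrt h)\<bar> \<le> L / sqrt h * norm (x - y)"
      using rho_lipD[of "x \<bullet> \<eta> / sqrt h" "y \<bullet> \<eta> / sqrt h"] by simp
    have "C / sqrt h * \<bar>norm x - norm y\<bar> \<le> C / sqrt h * norm (x - y)"
      using C_nonneg sqrt_h by (intro mult_left_mono norm_triangle_ineq3) auto
    then show "\<bar>\<zeta> (norm x) - \<zeta> (norm y)\<bar> \<le> C / sqrt h * norm (x - y)"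
      using zeta_lipD[of "norm x" "norm y"] by simp
  qed (auto intro: rho_bound zeta_bound constants_nonneg)
  then show ?thesis by (simp add: M_def add_divide_distrib)
qed

text \<open>The prefactor \<open>h\<close> compensates the slope \<open>1 / h\<close> of the layer
  profile exactly and that of the cut-offs with \<open>sqrt h\<close> to spare, so the constant
  stays bounded as \<open>h\<close> tends to 0.\<close>

lemma p_lip: "\<bar>p x - p y\<bar> \<le> (R * Z + M) * norm (x - y)"
proof -
  have "\<bar>p x - p y\<bar> \<le> (1 * (R * Z) + h * (M / sqrt h)) * norm (x - y)"
    unfolding p_def
  proof (rule product_lipschitz)
    have "\<bar>h * phi (x \<bullet> n / h) - h * phi (y \<bullet> n / h)\<bar> = h * \<bar>phi (x \<bullet> n / h) - phi (y \<bullet> n / h)\<bar>"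
      using h_pos by (simp add: right_diff_distrib[symmetric] abs_mult)
    also have "\<dots> \<le> h * \<bar>x \<bullet> n / h - y \<bullet> n / h\<bar>" using h_pos by (intro mult_left_mono phi_lipschitz) auto
    also have "\<dots> = \<bar>(x - y) \<bullet> n\<bar>"
      using h_pos by (simp add: inner_diff_left diff_divide_distrib[symmetric] abs_divide)
    also have "\<dots> \<le> norm (x - y)" using Cauchy_Schwarz_ineq2[of "x - y" n] n_unit by simp
    finally show "\<bar>h * phi (x \<bullet> n / h) - h * phi (y \<bullet> n / h)\<bar> \<le> 1 * norm (x - y)" by simp
    show "\<bar>h * phi (y \<bullet> n / h)\<bar> \<le> h" using h_pos phi_range by (simp add: abs_mult mult_left_le)
  qed (use h_pos constants_nonneg T_bound T_lip in auto)
  also have "\<dots> \<le> (R * Z + M) * norm (x - y)"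
  proof -
    have "h * (M / sqrt h) = sqrt h * M" using sqrt_h by (simp add: field_simps)
    also have "\<dots> \<le> M" using sqrt_h constants_nonneg by (intro mult_left_le_one_le) auto
    finally show ?thesis by (intro mult_right_mono) auto
  qed
  finally show ?thesis .
qed

lemma g_lip: "\<bar>g x - g y\<bar> \<le> K * norm (x - y)"
proof -
  have "\<bar>g x - g y\<bar> \<le> \<bar>p x - p y\<bar> + \<bar>p (- x) - p (- y)\<bar>" by (simp add: g_def)
  also have "\<dots> \<le> (R * Z + M) * norm (x - y) + (R * Z + M) * norm (- x - - y)"
    by (intro add_mono p_lip)
  finally show ?thesis by (simp add: K_def norm_minus_commute algebra_simps)
qed

lemma g_lipschitz: "K-lipschitz_on UNIV g"
  using g_lip constants_nonneg by (auto intro!: lipschitz_onI simp: dist_norm)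

lemma g_continuous: "continuous_on UNIV g"
  using g_lipschitz by (rule lipschitz_on_continuous_on)

lemma g_minus: "g (- x) = g x" by (simp add: g_def)

lemma g_supp: "1 \<le> norm x \<Longrightarrow> g x = 0"
  by (simp add: g_def p_def T_def zeta_zero)

text \<open>Above the layer \<open>phi\<close> is 0 in the direct summand and 1 in the reflected
  one. Only the cut-offs vary there, which leaves a gradient of order
  \<open>h / sqrt h = sqrt h\<close>.\<close>

lemma g_outside_layer: "h \<le> x \<bullet> n \<Longrightarrow> g x = h * T (- x)"
  using h_pos by (simp add: g_def p_def phi_def divide_le_0_iff zero_less_divide_iff)

lemma g_lip_outside_layer:
  assumes "h \<le> x \<bullet> n" "h \<le> y \<bullet> n"
  shows "\<bar>g x - g y\<bar> \<le> (M * sqrt h) * norm (x - y)"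
proof -
  have "\<bar>g x - g y\<bar> = h * \<bar>T (- x) - T (- y)\<bar>"
    using assms h_pos by (simp add: g_outside_layer right_diff_distrib[symmetric] abs_mult)
  also have "\<dots> \<le> h * (M / sqrt h * norm (- x - - y))"
    using h_pos by (intro mult_left_mono T_lip) auto
  also have "\<dots> = (M * sqrt h) * norm (x - y)"
    using sqrt_h by (simp add: norm_minus_commute field_simps)
  finally show ?thesis .
qed

lemma g_plane: "x \<bullet> n = 0 \<Longrightarrow> g x = h * ((\<rho> (x \<bullet> \<eta> / sqrt h) + \<rho> (- (x \<bullet> \<eta> / sqrt h))) * \<zeta> (norm x))"
  by (simp add: g_def p_def T_def phi_def algebra_simps)

text \<open>Discard the points at which some one-dimensional factor meets a bad argument: the
  hyperplanes \<open>x \<bullet> n = 0\<close>, \<open>h\<close> and \<open>- h\<close> for the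
  kinks of \<open>phi\<close> in both summands, and the preimages of the null sets belonging to
  \<open>\<rho>\<close> and \<open>\<zeta>\<close>. The origin is removed because the norm is not
  differentiable there.\<close>

lemma AE_differentiable: "AE x in lborel. g differentiable (at x)"
proof -
  \<comment> \<open>The cut-off is Lipschitz on the half line only; its even extension is Lipschitz
    on the whole line and gives the same composition with the norm.\<close>
  define \<zeta>' where "\<zeta>' t = \<zeta> \<bar>t\<bar>" for t
  define N1 where "N1 = {x. \<not> \<rho> differentiable (at x)}"
  define N2 where "N2 = {x. \<not> \<zeta>' differentiable (at x)}"
  have N1: "negligible N1" unfolding N1_def by (rule lipschitz_real_negligible_nondifferentiable[OF rho_lip])
  have "(C / sqrt h)-lipschitz_on UNIV \<zeta>'"
  proof (rule lipschitz_onI)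
    fix s t :: real
    have "C / sqrt h * \<bar>\<bar>s\<bar> - \<bar>t\<bar>\<bar> \<le> C / sqrt h * \<bar>s - t\<bar>"
      using C_nonneg sqrt_h by (intro mult_left_mono) auto
    then show "dist (\<zeta>' s) (\<zeta>' t) \<le> C / sqrt h * dist s t"
      using zeta_lipD[of "\<bar>s\<bar>" "\<bar>t\<bar>"] by (simp add: \<zeta>'_def dist_real_def)
  qed (use C_nonneg sqrt_h in simp)
  then have N2: "negligible N2" unfolding N2_def by (rule lipschitz_real_negligible_nondifferentiable)
  have lin: "negligible {x \<in> UNIV. x \<bullet> u \<in> N}" if "negligible N" "u \<noteq> 0" for N and u :: "real^'d"
  proof (rule negligible_vimage_submersion[OF that(1), where G = "\<lambda>_. u"])
    show "((\<lambda>x. x \<bullet> u) has_derivative (\<bullet>) u) (at x)" for x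
      by (auto intro!: derivative_eq_intros simp: inner_commute)
  qed (use that in auto)
  have nz: "\<eta> /\<^sub>R sqrt h \<noteq> 0" "- \<eta> /\<^sub>R sqrt h \<noteq> 0" "n \<noteq> 0"
    using eta_unit n_unit sqrt_h by auto
  have rad: "negligible {x \<in> - {0}. norm (x :: real^'d) \<in> N2}"
  proof (rule negligible_vimage_submersion[OF N2, where G = sgn])
    fix x :: "real^'d" assume "x \<in> - {0}"
    then have "GDERIV norm x :> sgn x" by (intro GDERIV_norm) auto
    moreover have "(\<lambda>w. w \<bullet> sgn x) = (\<bullet>) (sgn x)" by (rule ext) (rule inner_commute)
    ultimately show "(norm has_derivative (\<bullet>) (sgn x)) (at x)"
      by (simp only: gderiv_def)
  qed (auto simp: sgn_zero_iff)
  define B where "B = {x \<in> UNIV. x \<bullet> n \<in> {0, h, - h}} \<union> {x \<in> UNIV. x \<bullet> (\<eta> /\<^sub>R sqrt h) \<in> N1} \<union>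
    {x \<in> UNIV. x \<bullet> (- \<eta> /\<^sub>R sqrt h) \<in> N1} \<union> {x \<in> - {0}. norm x \<in> N2} \<union> {0}"
  have "negligible B"
    unfolding B_def by (intro negligible_Un lin N1 nz rad negligible_sing negligible_finite) auto
  then have "AE x in lborel. x \<notin> B" by (rule negligible_imp_AE_lborel)
  then show ?thesis
  proof eventually_elim
    case (elim x)
    have x: "x \<noteq> 0" "x \<bullet> n \<noteq> 0" "x \<bullet> n \<noteq> h" "x \<bullet> n \<noteq> - h" using elim by (auto simp: B_def)
    have r: "\<rho> differentiable (at (x \<bullet> \<eta> / sqrt h))" "\<rho> differentiable (at (- x \<bullet> \<eta> / sqrt h))"
      using elim by (auto simp: B_def N1_def divide_inverse mult.commute)
    have z: "\<zeta>' differentiable (at (norm x))" using elim x by (auto simp: B_def N2_def)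
    have z1: "(\<lambda>x. \<zeta>' (norm x)) differentiable (at x)"
      by (rule differentiable_compose[OF z differentiable_norm_at[OF x(1)]])
    have lin_diff: "(\<lambda>x. x \<bullet> u / c) differentiable (at x)" for u :: "real^'d" and c
      by (rule differentiableI, rule bounded_linear_imp_has_derivative,
          rule bounded_linear_compose[OF bounded_linear_divide bounded_linear_inner_left])
    have r1: "(\<lambda>x. \<rho> (x \<bullet> \<eta> / sqrt h)) differentiable (at x)"
      by (rule differentiable_compose[OF r(1) lin_diff])
    have r2: "(\<lambda>x. \<rho> (- x \<bullet> \<eta> / sqrt h)) differentiable (at x)"
      using differentiable_compose[of \<rho> "\<lambda>x. x \<bullet> (- \<eta>) / sqrt h", OF _ lin_diff] r(2) by simp
    have f1: "(\<lambda>x. phi (x \<bullet> n / h)) differentiable (at x)"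
      by (rule differentiable_compose[OF phi_differentiable lin_diff]) (use x h_pos in auto)
    have "phi differentiable (at (x \<bullet> (- n) / h))"
      using x h_pos by (intro phi_differentiable) (auto simp: divide_eq_eq)
    then have f2: "(\<lambda>x. phi (- x \<bullet> n / h)) differentiable (at x)"
      using differentiable_compose[of phi "\<lambda>x. x \<bullet> (- n) / h", OF _ lin_diff] by simp
    have "g = (\<lambda>x. h * phi (x \<bullet> n / h) * (\<rho> (x \<bullet> \<eta> / sqrt h) * \<zeta>' (norm x)) +
      h * phi (- x \<bullet> n / h) * (\<rho> (- x \<bullet> \<eta> / sqrt h) * \<zeta>' (norm x)))"
      by (simp add: fun_eq_iff g_def p_def T_def \<zeta>'_def)
    then show ?case
      using z1 r1 r2 f1 f2 by (auto intro!: differentiable_add differentiable_mult)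
  qed
qed

abbreviation "v \<equiv> gradient_of g"

lemma v_measurable[measurable]: "v \<in> borel_measurable borel"
  by (rule borel_measurable_gradient_of[OF g_continuous])

lemma AE_der: "AE x in lborel. (g has_derivative (\<lambda>w. v x \<bullet> w)) (at x)"
  using AE_differentiable by eventually_elim (rule has_derivative_gradient_of)

lemma AE_v_bound: "AE x in lborel. norm (v x) \<le> K"
  using AE_differentiable
  by eventually_elim (rule norm_gradient_of_le[where S = UNIV], auto intro: g_lip constants_nonneg)

lemma AE_v_bound_outside_layer: "AE x in lborel. h < x \<bullet> n \<longrightarrow> norm (v x) \<le> M * sqrt h"
  using AE_differentiable
proof eventually_elim
  case (elim x)
  show ?case
  proof
    assume x: "h < x \<bullet> n"
    have "open {y. h < y \<bullet> n}" by (intro open_Collect_less continuous_intros)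
    then show "norm (v x) \<le> M * sqrt h"
      by (rule norm_gradient_of_le[OF elim])
         (use x constants_nonneg sqrt_h in \<open>auto intro: g_lip_outside_layer\<close>)
  qed
qed

text \<open>With \<open>x \<bullet> \<eta>\<close> beyond the transition of \<open>\<rho>\<close>,
  the reflected summand vanishes and the direct one has all cut-offs equal to 1, so that
  \<open>g\<close> is locally \<open>h - x \<bullet> n\<close>.\<close>

lemma v_layer_plus:
  assumes "0 < x \<bullet> n" "x \<bullet> n < h" "sqrt h < x \<bullet> \<eta>" "norm x < 1 - sqrt h"
  shows "v x = - n"
proof (rule gradient_of_eqI)
  let ?S = "{x. 0 < x \<bullet> n} \<inter> {x. x \<bullet> n < h} \<inter> {x. sqrt h < x \<bullet> \<eta>} \<inter> {x. norm x < 1 - sqrt h}"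
  have "((\<lambda>x. h - x \<bullet> n) has_derivative (\<lambda>w. - n \<bullet> w)) (at x)"
    by (auto intro!: derivative_eq_intros simp: inner_commute)
  moreover have "open ?S" by (intro open_Int open_Collect_less continuous_intros)
  ultimately show "(g has_derivative (\<lambda>w. - n \<bullet> w)) (at x)"
  proof (rule has_derivative_transform_within_open)
    fix y assume y: "y \<in> ?S"
    then have y\<eta>: "sqrt h < y \<bullet> \<eta>" by simp
    with sqrt_h(1) have "0 < y \<bullet> \<eta>" by (rule less_trans)
    then have "\<rho> (- (y \<bullet> \<eta> / sqrt h)) = 0" using h_pos by (intro rho_zero) simp
    then have "T (- y) = 0" by (simp add: T_def)
    have "1 < y \<bullet> \<eta> / sqrt h" using y\<eta> h_pos by (simp add: pos_less_divide_eq)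
    then have "T y = 1" using y by (simp add: T_def rho_one zeta_one)
    have "h * phi (y \<bullet> n / h) = h - y \<bullet> n"
      using y h_pos by (simp add: phi_def divide_le_0_iff right_diff_distrib)
    with \<open>T (- y) = 0\<close> \<open>T y = 1\<close> show "h - y \<bullet> n = g y" by (simp add: g_def p_def)
  qed (use assms in auto)
qed

text \<open>Here only the reflected summand survives, and it is locally the constant
  \<open>h\<close>. This holds at every positive height, so it serves both the layer and the region
  above it.\<close>

lemma v_eta_negative:
  assumes "0 < x \<bullet> n" "x \<bullet> \<eta> < - sqrt h" "norm x < 1 - sqrt h"
  shows "v x = 0"
proof (rule gradient_of_eqI)
  let ?S = "{x. 0 < x \<bullet> n} \<inter> {x. x \<bullet> \<eta> < - sqrt h} \<inter> {x. norm x < 1 - sqrt h}"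
  have "((\<lambda>x. h) has_derivative (\<lambda>w. 0 \<bullet> w)) (at x)" by simp
  moreover have "open ?S" by (intro open_Int open_Collect_less continuous_intros)
  ultimately show "(g has_derivative (\<lambda>w. 0 \<bullet> w)) (at x)"
  proof (rule has_derivative_transform_within_open)
    fix y assume y: "y \<in> ?S"
    then have y\<eta>: "y \<bullet> \<eta> < - sqrt h" by simp
    then have "y \<bullet> \<eta> < 0" by (rule less_trans) (use h_pos in simp)
    then have "\<rho> (y \<bullet> \<eta> / sqrt h) = 0" using h_pos by (intro rho_zero) (simp add: divide_less_0_iff)
    moreover have "1 < - (y \<bullet> \<eta>) / sqrt h" using y\<eta> h_pos by (subst pos_less_divide_eq) auto
    moreover have "- (y \<bullet> n) / h \<le> 0" using y h_pos by (simp add: divide_le_0_iff)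
    ultimately show "h = g y"
      using y h_pos by (simp add: g_def p_def T_def rho_one rho_zero zeta_one phi_def)
  qed (use assms in auto)
qed

text \<open>Above the layer only the reflected summand could contribute, and for positive
  \<open>x \<bullet> \<eta>\<close> its factor \<open>\<rho>\<close> is 0.\<close>

lemma v_eta_positive:
  assumes "h < x \<bullet> n" "sqrt h < x \<bullet> \<eta>"
  shows "v x = 0"
proof (rule gradient_of_eqI)
  let ?S = "{x. h < x \<bullet> n} \<inter> {x. sqrt h < x \<bullet> \<eta>}"
  have "((\<lambda>x. 0) has_derivative (\<lambda>w. 0 \<bullet> w)) (at x)" by simp
  moreover have "open ?S" by (intro open_Int open_Collect_less continuous_intros)
  ultimately show "(g has_derivative (\<lambda>w. 0 \<bullet> w)) (at x)"
  proof (rule has_derivative_transform_within_open)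
    fix y assume y: "y \<in> ?S"
    then have "sqrt h < y \<bullet> \<eta>" by simp
    with sqrt_h(1) have "0 < y \<bullet> \<eta>" by (rule less_trans)
    then have "\<rho> (- (y \<bullet> \<eta> / sqrt h)) = 0" using h_pos by (intro rho_zero) simp
    then show "0 = g y" using y by (simp add: g_outside_layer T_def rho_zero)
  qed (use assms in auto)
qed

lemma v_outside_ball: "1 < norm x \<Longrightarrow> v x = 0"
proof (rule gradient_of_eqI)
  assume x: "1 < norm x"
  have "((\<lambda>x. 0) has_derivative (\<lambda>w. 0 \<bullet> w)) (at x)" by simp
  moreover have "open {x :: real^'d. 1 < norm x}" by (intro open_Collect_less continuous_intros)
  ultimately show "(g has_derivative (\<lambda>w. 0 \<bullet> w)) (at x)"
    by (rule has_derivative_transform_within_open) (use x in \<open>auto simp: g_supp\<close>)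
qed

end

section \<open>Limits on the half ball\<close>

text \<open>With \<open>t = sqrt h\<close> this set contains all points of the ball above the layer
  where the cut-offs are not locally constant. It is covered by a cylinder of height
  \<open>2 * t\<close> over a unit disc and a spherical shell of thickness \<open>t\<close>, whose
  volume Bernoulli's inequality bounds linearly in \<open>t\<close>.\<close>

lemma measure_boundary_strip_le:
  fixes \<eta> :: "real^'d"
  assumes \<eta>: "norm \<eta> = 1" and t: "0 < t" "t < 1"
  shows "measure lborel {z \<in> ball 0 1. \<bar>z \<bullet> \<eta>\<bar> \<le> t \<or> 1 - t \<le> norm z} \<le>
    (2 * unit_ball_vol (real CARD('d) - 1) + unit_ball_vol (real CARD('d)) * real CARD('d)) * t"
proof -
  \<comment> \<open>A slicing orthogonal to \<open>\<eta>\<close>, since the strip is thin in that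
    direction.\<close>
  obtain \<nu> :: "(real^'d \<Rightarrow> real) measure" and E where "slicing \<nu> \<eta> E" by (rule slicing_exists[OF \<eta>])
  then interpret slicing \<nu> \<eta> E .
  let ?A = "{z. z \<bullet> \<eta> \<in> {-t..t} \<and> z - (z \<bullet> \<eta>) *\<^sub>R \<eta> \<in> cball 0 1}"
  let ?S = "ball 0 1 - ball (0 :: real^'d) (1 - t)"
  have [measurable]: "cball (0 :: real^'d) 1 \<in> sets borel" by simp
  have [measurable]: "?A \<in> sets borel" by measurable
  have "emeasure lborel ?A = emeasure lborel {-t..t} * emeasure \<nu> {f \<in> space \<nu>. E f \<in> cball 0 1}"
    by (rule emeasure_cylinder) auto
  also have "\<dots> = ennreal (2 * t) * ennreal \<omega>" using t emeasure_nu_le by simp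
  also have "\<dots> = ennreal (2 * \<omega> * t)" using t \<omega>_pos by (simp add: ennreal_mult[symmetric] mult_ac)
  finally have eA: "emeasure lborel ?A = ennreal (2 * \<omega> * t)" .
  then have mA: "measure lborel ?A = 2 * \<omega> * t" using t \<omega>_pos by (simp add: measure_def)
  have fA: "?A \<in> fmeasurable lborel" using eA by (intro fmeasurableI) auto
  have fb: "ball (0 :: real^'d) r \<in> fmeasurable lborel" for r
    using emeasure_lborel_ball_finite[of "0 :: real^'d" r] by (intro fmeasurableI) auto
  have "measure lborel ?S = measure lborel (ball (0 :: real^'d) 1) - measure lborel (ball (0 :: real^'d) (1 - t))"
    using t fb by (intro measurable_measure_Diff) (auto simp: fmeasurable_def)
  also have "\<dots> = unit_ball_vol (real CARD('d)) * (1 - (1 - t) ^ CARD('d))"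
    using t content_ball[of 1 "0 :: real^'d"] content_ball[of "1 - t" "0 :: real^'d"]
    by (simp add: right_diff_distrib)
  also have "\<dots> \<le> unit_ball_vol (real CARD('d)) * (real CARD('d) * t)"
  proof (rule mult_left_mono)
    show "1 - (1 - t) ^ CARD('d) \<le> real CARD('d) * t"
      using Bernoulli_inequality[of "- t" "CARD('d)"] t by simp
  qed (simp add: unit_ball_vol_nonneg)
  finally have mS: "measure lborel ?S \<le> unit_ball_vol (real CARD('d)) * real CARD('d) * t" by simp
  have fS: "?S \<in> fmeasurable lborel" using fb by (intro fmeasurable.Diff) auto
  have "{z \<in> ball 0 1. \<bar>z \<bullet> \<eta>\<bar> \<le> t \<or> 1 - t \<le> norm z} \<subseteq> ?A \<union> ?S"
  proof
    fix z assume z: "z \<in> {z \<in> ball 0 1. \<bar>z \<bullet> \<eta>\<bar> \<le> t \<or> 1 - t \<le> norm z}"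
    show "z \<in> ?A \<union> ?S"
    proof (cases "\<bar>z \<bullet> \<eta>\<bar> \<le> t")
      case True
      have "(norm (z - (z \<bullet> \<eta>) *\<^sub>R \<eta>))\<^sup>2 = (norm z)\<^sup>2 - (z \<bullet> \<eta>)\<^sup>2"
        using \<eta> unfolding power2_norm_eq_inner
        by (simp add: inner_simps inner_commute norm_eq_1 power2_eq_square algebra_simps)
      then have "(norm (z - (z \<bullet> \<eta>) *\<^sub>R \<eta>))\<^sup>2 \<le> (norm z)\<^sup>2" by simp
      then have "norm (z - (z \<bullet> \<eta>) *\<^sub>R \<eta>) \<le> norm z" by (rule power2_le_imp_le) simp
      moreover have "norm z \<le> 1" using z by simp
      ultimately have "norm (z - (z \<bullet> \<eta>) *\<^sub>R \<eta>) \<le> 1" by linarith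
      then show ?thesis using True by (auto simp: abs_le_iff)
    next
      case False
      then show ?thesis using z by auto
    qed
  qed
  then have "measure lborel {z \<in> ball 0 1. \<bar>z \<bullet> \<eta>\<bar> \<le> t \<or> 1 - t \<le> norm z} \<le> measure lborel (?A \<union> ?S)"
    using fA fS by (intro measure_mono_fmeasurable) (auto intro: fmeasurable.Un)
  also have "\<dots> \<le> measure lborel ?A + measure lborel ?S"
    using fA fS by (intro measure_Un_le) auto
  also have "\<dots> \<le> 2 * \<omega> * t + unit_ball_vol (real CARD('d)) * real CARD('d) * t" using mA mS by simp
  finally show ?thesis by (simp add: \<omega>_def algebra_simps)
qed

text \<open>The limit is taken along sequences because dominated convergence is. One slicing serves
  all indices, and the bounds of the profiles do not depend on the index.\<close>

locale interchange_sequence = slicing \<nu> n E for \<nu> :: "'i measure" and n :: "real^'d" and E +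
  fixes \<eta> :: "real^'d" and h :: "nat \<Rightarrow> real" and C L :: real
    and \<zeta> :: "real \<Rightarrow> real \<Rightarrow> real" and \<rho> :: "real \<Rightarrow> real"
  assumes profile: "\<And>k. interchange_profile n \<eta> (h k) C L (\<zeta> (h k)) \<rho>"
    and h_lim: "h \<longlonglongrightarrow> 0"
begin

sublocale prof: interchange_profile n \<eta> "h k" C L "\<zeta> (h k)" \<rho> for k by (rule profile)

abbreviation "G \<equiv> prof.g"
abbreviation "u \<equiv> prof.v"

lemma u_measurable[measurable]: "u k \<in> borel_measurable borel" by (rule prof.v_measurable)

lemma ball_measurable[measurable]: "ball (0 :: real^'d) 1 \<in> sets borel" by simp

lemma sqrt_h_lim: "(\<lambda>k. sqrt (h k)) \<longlonglongrightarrow> 0"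
  using tendsto_real_sqrt[OF h_lim] by simp

lemma eventually_sqrt_h_less: "0 < e \<Longrightarrow> \<forall>\<^sub>F k in sequentially. sqrt (h k) < e"
  using order_tendstoD(2)[OF sqrt_h_lim] by blast

lemma \<eta>_ne: "\<eta> \<noteq> 0" "\<eta> \<bullet> n = 0" using prof.eta_unit prof.eta_perp by auto

text \<open>On the plane both layer profiles equal 1. At a point of the open disc with
  \<open>E f \<bullet> \<eta> \<noteq> 0\<close>, as soon as \<open>sqrt (h k)\<close> is below the
  distances to the transition zones, exactly one of the two values of \<open>\<rho>\<close> is 1 and
  the other 0; the integrand is then constantly 1.\<close>

lemma plane_integral_limit:
  "(\<lambda>k. (1 / h k) * (\<integral>f. G k (E f) \<partial>\<nu>)) \<longlonglongrightarrow> \<omega>"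
proof -
  let ?s = "\<lambda>k f. (\<rho> (E f \<bullet> \<eta> / sqrt (h k)) + \<rho> (- (E f \<bullet> \<eta> / sqrt (h k)))) * \<zeta> (h k) (norm (E f))"
  let ?B = "{f \<in> space \<nu>. norm (E f) < 1}"
  have Gm[measurable]: "G k \<in> borel_measurable borel" for k
    using prof.g_continuous by (rule borel_measurable_continuous_onI)
  have s_eq: "?s k f = (1 / h k) * G k (E f)" for k f
    using prof.g_plane[of "E f" k] E_n prof.h_pos[of k] by (simp add: inner_commute)
  have int: "(1 / h k) * (\<integral>f. G k (E f) \<partial>\<nu>) = (\<integral>f. ?s k f \<partial>\<nu>)" for k
    unfolding s_eq by simp
  have "(\<lambda>k. \<integral>f. ?s k f \<partial>\<nu>) \<longlonglongrightarrow> (\<integral>f. indicator ?B f \<partial>\<nu>)"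
  proof (rule integral_dominated_convergence)
    show "integrable \<nu> (\<lambda>f. (2 * prof.R * prof.Z) * indicator ?B f)"
      by (intro integrable_mult_right integrable_real_indicator) (auto simp: measure_nu_ball)
    show "?s k \<in> borel_measurable \<nu>" for k unfolding s_eq by measurable
    show "AE f in \<nu>. norm (?s k f) \<le> (2 * prof.R * prof.Z) * indicator ?B f" for k
    proof (rule AE_I2)
      fix f assume f: "f \<in> space \<nu>"
      show "norm (?s k f) \<le> (2 * prof.R * prof.Z) * indicator ?B f"
      proof (cases "norm (E f) < 1")
        case True
        have "\<bar>\<rho> (E f \<bullet> \<eta> / sqrt (h k)) + \<rho> (- (E f \<bullet> \<eta> / sqrt (h k)))\<bar> \<le> 2 * prof.R"
          using prof.rho_bound[of "E f \<bullet> \<eta> / sqrt (h k)"] prof.rho_bound[of "- (E f \<bullet> \<eta> / sqrt (h k))"] by linarith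
        then have "\<bar>\<rho> (E f \<bullet> \<eta> / sqrt (h k)) + \<rho> (- (E f \<bullet> \<eta> / sqrt (h k)))\<bar> * \<bar>\<zeta> (h k) (norm (E f))\<bar> \<le> (2 * prof.R) * prof.Z"
          using prof.constants_nonneg by (intro mult_mono prof.zeta_bound) auto
        then show ?thesis using True f by (simp add: abs_mult)
      qed (simp add: prof.zeta_zero)
    qed
    show "AE f in \<nu>. (\<lambda>k. ?s k f) \<longlonglongrightarrow> indicator ?B f"
      using AE_E_inner_nonzero[OF \<eta>_ne(2,1)] AE_space
    proof eventually_elim
      case (elim f)
      show ?case
      proof (cases "norm (E f) < 1")
        case True
        have "\<forall>\<^sub>F k in sequentially. sqrt (h k) < min \<bar>E f \<bullet> \<eta>\<bar> (1 - norm (E f))"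
          using elim True by (intro eventually_sqrt_h_less) auto
        then have "\<forall>\<^sub>F k in sequentially. ?s k f = 1"
        proof eventually_elim
          case (elim k)
          have pos: "0 < sqrt (h k)" by (rule prof.sqrt_h)
          have z: "\<zeta> (h k) (norm (E f)) = 1" using elim by (intro prof.zeta_one) auto
          consider "sqrt (h k) < E f \<bullet> \<eta>" | "sqrt (h k) < - (E f \<bullet> \<eta>)" using elim by linarith
          then have "\<rho> (E f \<bullet> \<eta> / sqrt (h k)) + \<rho> (- (E f \<bullet> \<eta> / sqrt (h k))) = 1"
          proof cases
            case 1
            then have "1 < E f \<bullet> \<eta> / sqrt (h k)" by (subst pos_less_divide_eq[OF pos]) simp
            then show ?thesis by (simp add: prof.rho_one prof.rho_zero)
          next
            case 2
            then have "1 < - (E f \<bullet> \<eta>) / sqrt (h k)" by (subst pos_less_divide_eq[OF pos]) simp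
            then show ?thesis by (simp add: prof.rho_one prof.rho_zero)
          qed
          then show ?case using z by simp
        qed
        then show ?thesis using True elim by (auto intro: tendsto_eventually)
      next
        case False
        then show ?thesis by (simp add: prof.zeta_zero)
      qed
    qed
  qed measurable
  then show ?thesis
    using measure_nu_ball \<omega>_pos unfolding int by (simp add: measure_def)
qed

lemma sphere_AE: "AE z in lborel. norm (z :: real^'d) \<noteq> 1"
  using negligible_imp_AE_lborel[OF negligible_sphere[of "0::real^'d" 1]] by simp

lemma hyperplane_AE: "AE z in lborel. z \<bullet> n \<noteq> c"
  by (rule AE_lborel_not_hyperplane) (use norm_n in auto)

text \<open>The linear part of the energy is not small pointwise outside the layer; only its integral is.\<close>
lemma linear_part_limit:
  "(\<lambda>k. (1 / h k) * (\<integral>z. indicator {z \<in> ball 0 1. 0 < z \<bullet> n} z * (q \<bullet> u k z) \<partial>lborel)) \<longlonglongrightarrow> - (q \<bullet> n) * \<omega>"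
proof -
  have "(\<integral>z. indicator {z \<in> ball 0 1. 0 < z \<bullet> n} z * (q \<bullet> u k z) \<partial>lborel) = - (q \<bullet> n) * (\<integral>f. G k (E f) \<partial>\<nu>)" for k
  proof -
    \<comment> \<open>The gradient vanishes outside the closed ball and the sphere is null, so the
      half ball may be enlarged to the half space.\<close>
    have "(\<integral>z. indicator {z \<in> ball 0 1. 0 < z \<bullet> n} z * (q \<bullet> u k z) \<partial>lborel) =
      (\<integral>z. indicator {z. 0 < z \<bullet> n} z * (q \<bullet> u k z) \<partial>lborel)"
    proof (rule integral_cong_AE)
      show "AE z in lborel. indicator {z \<in> ball 0 1. 0 < z \<bullet> n} z * (q \<bullet> u k z) = indicator {z. 0 < z \<bullet> n} z * (q \<bullet> u k z)"
        using sphere_AE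
      proof eventually_elim
        case (elim z)
        then show ?case using prof.v_outside_ball[of z k] by (cases "norm z < 1") (auto simp: indicator_def)
      qed
    qed measurable
    also have "\<dots> = - (q \<bullet> n) * (\<integral>f. G k (E f) \<partial>\<nu>)"
      by (rule half_space_gradient_integral[OF prof.g_lipschitz prof.g_supp prof.AE_der prof.v_measurable])
    finally show ?thesis .
  qed
  then have "(\<lambda>k. (1 / h k) * (\<integral>z. indicator {z \<in> ball 0 1. 0 < z \<bullet> n} z * (q \<bullet> u k z) \<partial>lborel)) =
    (\<lambda>k. - (q \<bullet> n) * ((1 / h k) * (\<integral>f. G k (E f) \<partial>\<nu>)))"
    by (simp add: fun_eq_iff)
  then show ?thesis using tendsto_mult_left[OF plane_integral_limit, of "- (q \<bullet> n)"] by simp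
qed

text \<open>Rescaling heights by \<open>h k\<close> cancels the prefactor, and at almost every point
  of the fixed product space the gradient is eventually \<open>- n\<close> or 0, according to the
  sign of \<open>E f \<bullet> \<eta>\<close>; since \<open>r 0 = 0\<close>, only the positive half
  disc counts.\<close>

lemma layer_limit:
  fixes r :: "real^'d \<Rightarrow> real"
  assumes cont: "continuous_on UNIV r" and r0: "r 0 = 0"
  shows "(\<lambda>k. (1 / h k) * (\<integral>z. indicator {z \<in> ball 0 1. 0 < z \<bullet> n \<and> z \<bullet> n < h k} z * r (u k z) \<partial>lborel))
    \<longlonglongrightarrow> \<omega> / 2 * r (- n)"
proof -
  have rm[measurable]: "r \<in> borel_measurable borel" using cont by (rule borel_measurable_continuous_onI)
  obtain W0 where W0: "\<And>p. norm p \<le> prof.K \<Longrightarrow> \<bar>r p\<bar> \<le> W0"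
    using continuous_bounded_on_cball[OF cont] by blast
  have "\<bar>r 0\<bar> \<le> W0" by (rule W0) (simp add: prof.constants_nonneg)
  then have W0_nonneg: "0 \<le> W0" by simp
  let ?F = "\<lambda>k x. indicator (ball 0 1) (slab_map (h k) x) * (indicator {0<..<1} (fst x) * r (u k (slab_map (h k) x)))"
  let ?A = "{f \<in> space \<nu>. norm (E f) < 1 \<and> 0 < E f \<bullet> \<eta>}"
  have int: "(1 / h k) * (\<integral>z. indicator {z \<in> ball 0 1. 0 < z \<bullet> n \<and> z \<bullet> n < h k} z * r (u k z) \<partial>lborel) =
    (\<integral>x. ?F k x \<partial>(lborel \<Otimes>\<^sub>M \<nu>))" for k
  proof -
    have hp: "0 < h k" by (rule prof.h_pos)
    have "(\<integral>z. indicator {z \<in> ball 0 1. 0 < z \<bullet> n \<and> z \<bullet> n < h k} z * r (u k z) \<partial>lborel) =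
      h k * (\<integral>x. indicator {z \<in> ball 0 1. 0 < z \<bullet> n \<and> z \<bullet> n < h k} (slab_map (h k) x) * r (u k (slab_map (h k) x)) \<partial>(lborel \<Otimes>\<^sub>M \<nu>))"
      by (rule integral_slice[OF hp]) measurable
    also have "(\<lambda>x. indicator {z \<in> ball 0 1. 0 < z \<bullet> n \<and> z \<bullet> n < h k} (slab_map (h k) x) * r (u k (slab_map (h k) x))) = ?F k"
    proof
      fix x :: "real \<times> 'i"
      obtain s f where x: "x = (s, f)" by (cases x)
      have "slab_map (h k) x \<bullet> n = h k * s" unfolding x by (rule slab_map_inner)
      then have "0 < slab_map (h k) x \<bullet> n \<longleftrightarrow> 0 < s" "slab_map (h k) x \<bullet> n < h k \<longleftrightarrow> s < 1"
        using hp by (auto simp: zero_less_mult_iff)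
      then show "indicator {z \<in> ball 0 1. 0 < z \<bullet> n \<and> z \<bullet> n < h k} (slab_map (h k) x) * r (u k (slab_map (h k) x)) = ?F k x"
        by (simp add: indicator_def x)
    qed
    finally show ?thesis using hp by simp
  qed
  have "(\<lambda>k. \<integral>x. ?F k x \<partial>(lborel \<Otimes>\<^sub>M \<nu>)) \<longlonglongrightarrow> (\<integral>x. indicator ({0<..<1::real} \<times> ?A) x * r (- n) \<partial>(lborel \<Otimes>\<^sub>M \<nu>))"
  proof (rule integral_dominated_convergence)
    show "integrable (lborel \<Otimes>\<^sub>M \<nu>) (\<lambda>x. W0 * (case x of (s, f) \<Rightarrow> indicator {0..1::real} s * indicator {f \<in> space \<nu>. norm (E f) \<le> 1} f))"
      by (intro integrable_mult_right integrable_slab)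
    have bound: "AE x in lborel \<Otimes>\<^sub>M \<nu>. norm (u k (slab_map (h k) x)) \<le> prof.K" for k
      by (rule AE_slice[OF prof.h_pos prof.AE_v_bound])
    show "AE x in lborel \<Otimes>\<^sub>M \<nu>. norm (?F k x) \<le> W0 * (case x of (s, f) \<Rightarrow> indicator {0..1::real} s * indicator {f \<in> space \<nu>. norm (E f) \<le> 1} f)" for k
      using bound[of k] AE_space[of "(lborel :: real measure) \<Otimes>\<^sub>M \<nu>"]
    proof eventually_elim
      case (elim x)
      obtain s f where x: "x = (s, f)" by (cases x)
      have f: "f \<in> space \<nu>" using elim(2) by (simp add: x space_pair_measure)
      have b: "\<bar>r (u k (slab_map (h k) x))\<bar> \<le> W0" using elim(1) by (rule W0)
      show ?case
      proof (cases "slab_map (h k) x \<in> ball 0 1 \<and> s \<in> {0<..<1}")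
        case True
        then have "norm (E f) \<le> 1" using norm_E_le[of f "h k * s"] by (simp add: x)
        then show ?thesis using True b f by (simp add: x)
      next
        case False
        then have "norm (?F k x) = 0" by (auto simp: x indicator_def)
        then show ?thesis by (simp only:) (simp add: x W0_nonneg)
      qed
    qed
    \<comment> \<open>The component along \<open>\<eta>\<close> does not depend on the height, so
      excluding this hyperplane at the single scale 1 excludes it at all scales
      \<open>h k\<close>.\<close>
    have "AE z in lborel. z \<bullet> \<eta> \<noteq> 0" by (rule AE_lborel_not_hyperplane[OF \<eta>_ne(1)])
    then have "AE x in lborel \<Otimes>\<^sub>M \<nu>. slab_map 1 x \<bullet> \<eta> \<noteq> 0"
      by (rule AE_slice[OF zero_less_one])
    then show "AE x in lborel \<Otimes>\<^sub>M \<nu>. (\<lambda>k. ?F k x) \<longlonglongrightarrow> indicator ({0<..<1::real} \<times> ?A) x * r (- n)"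
      using AE_space[of "(lborel :: real measure) \<Otimes>\<^sub>M \<nu>"]
    proof eventually_elim
      case (elim x)
      obtain s f where x: "x = (s, f)" by (cases x)
      have f: "f \<in> space \<nu>" using elim(2) by (simp add: x space_pair_measure)
      have slab_\<eta>: "slab_map \<tau> x \<bullet> \<eta> = E f \<bullet> \<eta>" for \<tau>
        using \<eta>_ne by (simp add: x inner_simps inner_commute)
      then have ne: "E f \<bullet> \<eta> \<noteq> 0" using elim(1) by metis
      show ?case
      proof (cases "norm (E f) < 1 \<and> s \<in> {0<..<1}")
        case False
        have "?F k x = 0" for k
        proof (cases "s \<in> {0<..<1}")
          case True
          then have "1 \<le> norm (E f)" using False by simp
          then have "1 \<le> norm (slab_map (h k) x)" using norm_E_le[of f "h k * s"] by (simp add: x)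
          then show ?thesis by simp
        qed (simp add: x)
        moreover have "indicator ({0<..<1::real} \<times> ?A) x * r (- n) = 0"
          using False by (auto simp: x indicator_def)
        ultimately show ?thesis by (simp only: tendsto_const)
      next
        case True
        \<comment> \<open>Half of the distance to the unit sphere: \<open>sqrt (h k)\<close> is used
          once to absorb the height \<open>h k * s \<le> sqrt (h k)\<close> and once to reach the
          region where \<open>\<zeta>\<close> equals 1.\<close>
        have "\<forall>\<^sub>F k in sequentially. sqrt (h k) < min \<bar>E f \<bullet> \<eta>\<bar> ((1 - norm (E f)) / 2)"
          using ne True by (intro eventually_sqrt_h_less) auto
        then have "\<forall>\<^sub>F k in sequentially. ?F k x = indicator ({0<..<1::real} \<times> ?A) x * r (- n)"
        proof eventually_elim
          case (elim k)
          have hs: "0 < h k * s" "h k * s < h k" using True prof.h_pos[of k] by auto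
          have "norm (slab_map (h k) x) \<le> \<bar>h k * s\<bar> + norm (E f)"
            using norm_triangle_ineq[of "(h k * s) *\<^sub>R n" "E f"] norm_n by (simp add: x)
          then have small: "norm (slab_map (h k) x) < 1 - sqrt (h k)"
            using elim hs prof.sqrt_h(4)[of k] by simp
          then have "norm (slab_map (h k) x) < 1" using prof.sqrt_h(1)[of k] by linarith
          then have inB: "slab_map (h k) x \<in> ball 0 1" by simp
          have sn: "slab_map (h k) x \<bullet> n = h k * s" unfolding x by (rule slab_map_inner)
          consider "sqrt (h k) < E f \<bullet> \<eta>" | "E f \<bullet> \<eta> < - sqrt (h k)" using elim by linarith
          then show ?case
          proof cases
            case 1
            have "u k (slab_map (h k) x) = - n"
              by (rule prof.v_layer_plus) (use 1 hs sn small in \<open>auto simp: slab_\<eta>\<close>)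
            moreover have "0 < E f \<bullet> \<eta>" using prof.sqrt_h(1) 1 by (rule less_trans)
            ultimately show ?thesis using inB True f by (simp add: x)
          next
            case 2
            have "u k (slab_map (h k) x) = 0"
              by (rule prof.v_eta_negative) (use 2 hs sn small in \<open>auto simp: slab_\<eta>\<close>)
            moreover have "\<not> 0 < E f \<bullet> \<eta>" using prof.sqrt_h(1)[of k] 2 by linarith
            ultimately show ?thesis using r0 by (simp add: x)
          qed
        qed
        then show ?thesis by (rule tendsto_eventually)
      qed
    qed
  qed measurable
  also have "(\<integral>x. indicator ({0<..<1::real} \<times> ?A) x * r (- n) \<partial>(lborel \<Otimes>\<^sub>M \<nu>)) = \<omega> / 2 * r (- n)"
  proof -
    have "emeasure (lborel \<Otimes>\<^sub>M \<nu>) ({0<..<1::real} \<times> ?A) = ennreal (\<omega> / 2)"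
      using measure_nu_half_ball[OF \<eta>_ne(2,1)] by (subst emeasure_pair_measure_Times) auto
    then have "measure (lborel \<Otimes>\<^sub>M \<nu>) ({0<..<1::real} \<times> ?A) = \<omega> / 2"
      using \<omega>_pos by (simp add: measure_def)
    moreover have "{0<..<1::real} \<times> ?A \<subseteq> space (lborel \<Otimes>\<^sub>M \<nu>)" by (auto simp: space_pair_measure)
    ultimately show ?thesis by (simp add: Int_absorb2)
  qed
  finally show ?thesis unfolding int .
qed

lemma integrable_bounded_density:
  fixes r :: "real^'d \<Rightarrow> real"
  assumes cont: "continuous_on UNIV r" and A[measurable]: "A \<in> sets borel" and sub: "A \<subseteq> ball 0 1"
  shows "integrable lborel (\<lambda>z. indicator A z * r (u k z))"
proof -
  have rm[measurable]: "r \<in> borel_measurable borel" using cont by (rule borel_measurable_continuous_onI)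
  obtain c where c: "\<And>p. norm p \<le> prof.K \<Longrightarrow> \<bar>r p\<bar> \<le> c"
    using continuous_bounded_on_cball[OF cont] by blast
  show ?thesis
  proof (rule Bochner_Integration.integrable_bound)
    show "integrable lborel (\<lambda>z. c * indicator (ball 0 1 :: (real^'d) set) z)"
      using emeasure_lborel_ball_finite[of "0 :: real^'d" 1]
      by (intro integrable_mult_right integrable_real_indicator) auto
    show "AE z in lborel. norm (indicator A z * r (u k z)) \<le> norm (c * indicator (ball 0 1) z)"
      using prof.AE_v_bound[of k]
    proof eventually_elim
      case (elim z)
      then have "norm (r (u k z)) \<le> c" using c by simp
      then show ?case using sub by (auto simp: indicator_def)
    qed
  qed measurable
qed

lemma remainder_limit:
  fixes r :: "real^'d \<Rightarrow> real"
  assumes cont: "continuous_on UNIV r"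
    and small: "\<And>\<epsilon>. 0 < \<epsilon> \<Longrightarrow> \<exists>\<delta>>0. \<forall>p. norm p < \<delta> \<longrightarrow> \<bar>r p\<bar> \<le> \<epsilon> * norm p"
  shows "(\<lambda>k. (1 / h k) * (\<integral>z. indicator {z \<in> ball 0 1. h k < z \<bullet> n} z * r (u k z) \<partial>lborel)) \<longlonglongrightarrow> 0"
proof (rule tendstoI)
  fix e :: real assume e: "0 < e"
  define c where "c = 2 * unit_ball_vol (real CARD('d) - 1) + unit_ball_vol (real CARD('d)) * real CARD('d)"
  have c: "0 \<le> c" using \<omega>_pos by (simp add: c_def \<omega>_def unit_ball_vol_nonneg)
  define M where "M = prof.M"
  have M: "0 \<le> M" unfolding M_def by (rule prof.constants_nonneg)
  \<comment> \<open>The gradient bound \<open>M * sqrt h\<close> and the strip measure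
    \<open>c * sqrt h\<close> multiply to \<open>M * c * h\<close>, so the quotient is at most
    \<open>\<epsilon> * (M * c)\<close>, below \<open>e\<close>. Adding 1 avoids division by
    0.\<close>
  define \<epsilon> where "\<epsilon> = e / (2 * (M * c + 1))"
  have Mc: "0 \<le> M * c" using M c by simp
  then have \<epsilon>: "0 < \<epsilon>" using e by (simp add: \<epsilon>_def)
  have "\<epsilon> * (M * c) \<le> \<epsilon> * (M * c + 1)" using \<epsilon> by (intro mult_left_mono) auto
  also have "\<dots> = e / 2"
  proof -
    have "\<epsilon> * d = e / 2" if "\<epsilon> = e / (2 * d)" "d \<noteq> 0" for d using that by simp
    from this[OF \<epsilon>_def] show ?thesis using Mc by linarith
  qed
  finally have \<epsilon>e: "\<epsilon> * (M * c) < e" using e by simp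
  obtain \<delta> where \<delta>: "\<delta> > 0" "\<And>p. norm p < \<delta> \<Longrightarrow> \<bar>r p\<bar> \<le> \<epsilon> * norm p" using small[OF \<epsilon>] by blast
  have r0: "r 0 = 0" using \<delta>(2)[of 0] \<delta>(1) by simp
  \<comment> \<open>Ensures \<open>M * sqrt (h k) < \<delta>\<close>, so that the smallness of
    \<open>r\<close> applies to every gradient outside the layer; again \<open>M\<close> may be
    0.\<close>
  have "\<forall>\<^sub>F k in sequentially. sqrt (h k) < \<delta> / (M + 1)"
    using \<delta>(1) M by (intro eventually_sqrt_h_less) auto
  then show "\<forall>\<^sub>F k in sequentially. dist ((1 / h k) *
    (\<integral>z. indicator {z \<in> ball 0 1. h k < z \<bullet> n} z * r (u k z) \<partial>lborel)) 0 < e"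
  proof eventually_elim
    case (elim k)
    have hp: "0 < h k" "0 < sqrt (h k)" "sqrt (h k) < 1" using prof.h_pos[of k] prof.sqrt_h[of k] by auto
    have "M * sqrt (h k) \<le> (M + 1) * sqrt (h k)" using hp by (intro mult_right_mono) auto
    also have "\<dots> < \<delta>" using elim M by (simp add: pos_less_divide_eq mult.commute)
    finally have M\<delta>: "M * sqrt (h k) < \<delta>" .
    let ?D = "{z \<in> ball 0 1. h k < z \<bullet> n}"
    let ?S = "{z \<in> ball 0 1. \<bar>z \<bullet> \<eta>\<bar> \<le> sqrt (h k) \<or> 1 - sqrt (h k) \<le> norm z}"
    have [measurable]: "?D \<in> sets borel" "?S \<in> sets borel" by measurable
    have iD: "integrable lborel (\<lambda>z. indicator ?D z * r (u k z))"
      by (rule integrable_bounded_density[OF cont]) auto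
    have "emeasure lborel ?S \<le> emeasure lborel (ball (0 :: real^'d) 1)" by (rule emeasure_mono) auto
    also have "\<dots> < \<infinity>" using emeasure_lborel_ball_finite[of "0 :: real^'d" 1] by simp
    finally have iS: "integrable lborel (indicator ?S :: _ \<Rightarrow> real)" by (intro integrable_real_indicator) auto
    have "\<bar>\<integral>z. indicator ?D z * r (u k z) \<partial>lborel\<bar> \<le> (\<integral>z. \<bar>indicator ?D z * r (u k z)\<bar> \<partial>lborel)"
      using integral_norm_bound[of lborel "\<lambda>z. indicator ?D z * r (u k z)"] by simp
    also have "\<dots> \<le> (\<integral>z. (\<epsilon> * (M * sqrt (h k))) * indicator ?S z \<partial>lborel)"
    proof (rule integral_mono_AE)
      show "integrable lborel (\<lambda>z. \<bar>indicator ?D z * r (u k z)\<bar>)" using iD by (rule integrable_abs)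
      show "integrable lborel (\<lambda>z. (\<epsilon> * (M * sqrt (h k))) * indicator ?S z)"
        by (rule integrable_mult_right) (rule iS)
      show "AE z in lborel. \<bar>indicator ?D z * r (u k z)\<bar> \<le> (\<epsilon> * (M * sqrt (h k))) * indicator ?S z"
        using prof.AE_v_bound_outside_layer[of k]
      proof eventually_elim
        case (elim z)
        have nn: "0 \<le> \<epsilon> * (M * sqrt (h k))" using \<epsilon> M hp by simp
        show ?case
        proof (cases "z \<in> ?D")
          case False
          then show ?thesis using nn by simp
        next
          case D: True
          then have ub: "norm (u k z) \<le> M * sqrt (h k)" using elim by (simp add: M_def)
          then have "\<bar>r (u k z)\<bar> \<le> \<epsilon> * norm (u k z)" using M\<delta> by (intro \<delta>) simp
          also have "\<dots> \<le> \<epsilon> * (M * sqrt (h k))" using ub \<epsilon> by (intro mult_left_mono) auto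
          finally have b: "\<bar>r (u k z)\<bar> \<le> \<epsilon> * (M * sqrt (h k))" .
          show ?thesis
          proof (cases "z \<in> ?S")
            case True
            then show ?thesis using D b by simp
          next
            case False
            then have ns: "sqrt (h k) < \<bar>z \<bullet> \<eta>\<bar>" "norm z < 1 - sqrt (h k)" using D by auto
            have zn: "h k < z \<bullet> n" using D by simp
            with hp(1) have "0 < z \<bullet> n" by (rule less_trans)
            consider "sqrt (h k) < z \<bullet> \<eta>" | "z \<bullet> \<eta> < - sqrt (h k)" using ns by linarith
            then have "u k z = 0"
            proof cases
              case 1
              show ?thesis by (rule prof.v_eta_positive[OF zn 1])
            next
              case 2
              show ?thesis by (rule prof.v_eta_negative[OF \<open>0 < z \<bullet> n\<close> 2 ns(2)])
            qed
            then show ?thesis using nn r0 by simp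
          qed
        qed
      qed
    qed
    also have "\<dots> = \<epsilon> * (M * sqrt (h k)) * measure lborel ?S" by simp
    also have "\<dots> \<le> \<epsilon> * (M * sqrt (h k)) * (c * sqrt (h k))"
      unfolding c_def using \<epsilon> M hp prof.eta_unit by (intro mult_left_mono measure_boundary_strip_le) auto
    also have "\<dots> = \<epsilon> * (M * c) * h k"
      using prof.sqrt_h(3)[of k] by (simp add: mult_ac)
    finally have "\<bar>\<integral>z. indicator ?D z * r (u k z) \<partial>lborel\<bar> / h k \<le> \<epsilon> * (M * c)"
      using hp by (simp add: pos_divide_le_eq)
    then show ?case using \<epsilon>e hp by (simp add: dist_real_def abs_mult)
  qed
qed

text \<open>The layer contributes \<open>\<omega> / 2\<close> times
  \<open>w (- n) - w 0 + q \<bullet> n\<close> and the linear part \<open>- \<omega>\<close> times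
  \<open>q \<bullet> n\<close>; half of the latter is compensated.\<close>

lemma half_ball_limit:
  fixes w :: "real^'d \<Rightarrow> real"
  assumes cont: "continuous_on UNIV w" and der: "(w has_derivative (\<lambda>p. q \<bullet> p)) (at 0)"
  shows "(\<lambda>k. (1 / h k) * (\<integral>z. indicator {z \<in> ball 0 1. 0 < z \<bullet> n} z * (w (u k z) - w 0) \<partial>lborel))
    \<longlonglongrightarrow> \<omega> / 2 * (w (- n) - w 0 - q \<bullet> n)"
proof -
  define r where "r p = w p - w 0 - q \<bullet> p" for p
  have contr: "continuous_on UNIV r" unfolding r_def by (intro continuous_intros cont)
  have contq: "continuous_on UNIV (\<lambda>p. q \<bullet> p)" by (intro continuous_intros)
  have r0: "r 0 = 0" by (simp add: r_def)
  have small: "\<exists>\<delta>>0. \<forall>p. norm p < \<delta> \<longrightarrow> \<bar>r p\<bar> \<le> \<epsilon> * norm p" if "0 < \<epsilon>" for \<epsilon>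
    using der that unfolding has_derivative_at_alt r_def by simp
  let ?H = "{z \<in> ball 0 1. 0 < z \<bullet> n}"
  let ?Y = "\<lambda>k. {z \<in> ball 0 1. 0 < z \<bullet> n \<and> z \<bullet> n < h k}"
  let ?O = "\<lambda>k. {z \<in> ball 0 1. h k < z \<bullet> n}"
  have "(\<integral>z. indicator ?H z * (w (u k z) - w 0) \<partial>lborel) =
    (\<integral>z. indicator ?H z * (q \<bullet> u k z) \<partial>lborel) + (\<integral>z. indicator (?Y k) z * r (u k z) \<partial>lborel)
    + (\<integral>z. indicator (?O k) z * r (u k z) \<partial>lborel)" for k
  proof -
    have i: "integrable lborel (\<lambda>z. indicator ?H z * (q \<bullet> u k z))"
      "integrable lborel (\<lambda>z. indicator (?Y k) z * r (u k z))"
      "integrable lborel (\<lambda>z. indicator (?O k) z * r (u k z))"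
      by (rule integrable_bounded_density[OF contq] integrable_bounded_density[OF contr]; auto)+
    have [measurable]: "w \<in> borel_measurable borel" using cont by (rule borel_measurable_continuous_onI)
    have [measurable]: "r \<in> borel_measurable borel" using contr by (rule borel_measurable_continuous_onI)
    have "(\<integral>z. indicator ?H z * (w (u k z) - w 0) \<partial>lborel) =
      (\<integral>z. indicator ?H z * (q \<bullet> u k z) + indicator (?Y k) z * r (u k z) + indicator (?O k) z * r (u k z) \<partial>lborel)"
    proof (rule integral_cong_AE)
      show "AE z in lborel. indicator ?H z * (w (u k z) - w 0) =
        indicator ?H z * (q \<bullet> u k z) + indicator (?Y k) z * r (u k z) + indicator (?O k) z * r (u k z)"
        using hyperplane_AE[of "h k"]
      proof eventually_elim
        case (elim z)
        have hp: "0 < h k" by (rule prof.h_pos)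
        consider "z \<notin> ball 0 1 \<or> z \<bullet> n \<le> 0" | "z \<in> ball 0 1" "0 < z \<bullet> n" "z \<bullet> n < h k" | "z \<in> ball 0 1" "h k < z \<bullet> n"
          using elim by linarith
        then show ?case
        proof cases
          case 1 then show ?thesis using hp by (auto simp: indicator_def)
        next
          case 2 then show ?thesis by (simp add: r_def)
        next
          case 3
          then have "0 < z \<bullet> n" using hp by linarith
          with 3 show ?thesis by (simp add: r_def)
        qed
      qed
    qed measurable
    then show ?thesis using i by simp
  qed
  then have "(\<lambda>k. (1 / h k) * (\<integral>z. indicator ?H z * (w (u k z) - w 0) \<partial>lborel)) =
    (\<lambda>k. (1 / h k) * (\<integral>z. indicator ?H z * (q \<bullet> u k z) \<partial>lborel)
      + (1 / h k) * (\<integral>z. indicator (?Y k) z * r (u k z) \<partial>lborel)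
      + (1 / h k) * (\<integral>z. indicator (?O k) z * r (u k z) \<partial>lborel))"
    by (simp add: fun_eq_iff distrib_left)
  moreover have "\<dots> \<longlonglongrightarrow> - (q \<bullet> n) * \<omega> + \<omega> / 2 * r (- n) + 0"
    by (intro tendsto_add linear_part_limit layer_limit[OF contr r0] remainder_limit[OF contr small])
  moreover have "- (q \<bullet> n) * \<omega> + \<omega> / 2 * r (- n) + 0 = \<omega> / 2 * (w (- n) - w 0 - q \<bullet> n)"
    by (simp add: r_def field_simps)
  ultimately show ?thesis by (simp only:)
qed

end

section \<open>The interchange variation\<close>

lemma outer_add: "outer a (p + q) = outer a p + outer a q"
  by (simp add: outer_def vec_eq_iff algebra_simps)

lemma outer_scaleR: "outer a (c *\<^sub>R p) = c *\<^sub>R outer a p"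
  by (simp add: outer_def vec_eq_iff)

lemma bounded_linear_outer: "bounded_linear (outer a)"
  by (simp add: linear_conv_bounded_linear[symmetric] linearI outer_add outer_scaleR)

lemma jacobian_eqI:
  assumes "(f has_derivative D) (at x)"
  shows "jacobian f (at x) = matrix D"
  using frechet_derivative_at[OF assms] by (simp add: jacobian_def)

lemma matrix_rank_one: "matrix (\<lambda>w. (v \<bullet> w) *\<^sub>R a) = outer a v"
  by (simp add: matrix_def outer_def vec_eq_iff inner_axis mult.commute)

lemma C2_on_differentiable:
  assumes "C2_on U f" "x \<in> U"
  shows "f differentiable (at x)"
  using assms unfolding C2_on_def by (auto intro: differentiableI)

lemma has_derivative_matrix_gradient:
  assumes "W differentiable (at F)"
  shows "(W has_derivative (\<lambda>H. matrix_gradient W F \<bullet> H)) (at F)"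
proof -
  have D: "(W has_derivative (\<lambda>H. gradient_of W F \<bullet> H)) (at F)"
    by (rule has_derivative_gradient_of[OF assms])
  then have "matrix_gradient W F = gradient_of W F"
    by (intro matrix_gradient_eqI) (simp add: frobenius_eq_inner)
  with D show ?thesis by simp
qed

text \<open>The vector \<open>q\<close> is the transpose of the matrix gradient applied to
  \<open>a\<close>. It reduces the energy to a function on the domain space, as the half ball limit
  requires.\<close>

lemma gradient_along_rank_one:
  fixes W :: "real^'d^'m \<Rightarrow> real"
  assumes "W differentiable (at F)"
  obtains q where "((\<lambda>p. W (F + outer a p)) has_derivative (\<lambda>p. q \<bullet> p)) (at 0)"
    and "\<And>p. q \<bullet> p = matrix_gradient W F \<bullet> outer a p"
proof -
  have o: "((\<lambda>p. F + outer a p) has_derivative outer a) (at 0)"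
    using bounded_linear_imp_has_derivative[OF bounded_linear_outer, of a "at 0"]
    by (auto intro!: derivative_eq_intros)
  have z: "outer a (0 :: real^'d) = 0" using linear_0[OF bounded_linear.linear[OF bounded_linear_outer]] .
  have D: "((\<lambda>p. W (F + outer a p)) has_derivative (\<lambda>p. matrix_gradient W F \<bullet> outer a p)) (at 0)"
    by (rule has_derivative_compose[OF o]) (use has_derivative_matrix_gradient[OF assms] z in simp)
  define q where "q = gradient_of (\<lambda>p. W (F + outer a p)) 0"
  have q: "((\<lambda>p. W (F + outer a p)) has_derivative (\<lambda>p. q \<bullet> p)) (at 0)"
    unfolding q_def by (rule has_derivative_gradient_of[OF differentiableI[OF D]])
  have "q \<bullet> p = matrix_gradient W F \<bullet> outer a p" for p
    using has_derivative_unique[OF q D] by meson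
  with q show thesis by (rule that)
qed

section \<open>From the scalar profile back to the vector-valued variation\<close>

context interchange_profile
begin

lemma Phi_eq:
  assumes "\<zeta>f h = \<zeta>"
  shows "Phi a n \<eta> \<zeta>f \<rho> h = (\<lambda>z. g z *\<^sub>R a)"
  by (simp add: fun_eq_iff Phi_def Phi_minus_def Phi_plus_def g_def p_def T_def assms scaleR_add_left mult_ac)

lemma jacobian_Phi:
  assumes "\<zeta>f h = \<zeta>" "(g has_derivative (\<lambda>w. v z \<bullet> w)) (at z)"
  shows "jacobian (Phi a n \<eta> \<zeta>f \<rho> h) (at z) = outer a (v z)"
proof -
  have "((\<lambda>z. g z *\<^sub>R a) has_derivative (\<lambda>w. (v z \<bullet> w) *\<^sub>R a)) (at z)"
    by (rule has_derivative_scaleR_left[OF assms(2)])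
  from jacobian_eqI[OF this] show ?thesis
    unfolding Phi_eq[where \<zeta>f = \<zeta>f, OF assms(1)] by (simp add: matrix_rank_one)
qed

text \<open>An even function has an odd gradient; differentiability at \<open>z\<close> passes to
  \<open>- z\<close> through the reflection, so no second null set is involved.\<close>

lemma AE_v_odd: "AE z in lborel. v (- z) = - v z"
  using AE_der
proof eventually_elim
  case (elim z)
  have "((\<lambda>x. g (- x)) has_derivative (\<lambda>w. v z \<bullet> (- w))) (at (- z))"
    by (rule has_derivative_compose[of uminus uminus "- z" UNIV g])
       (use elim in \<open>auto intro!: derivative_eq_intros\<close>)
  then show ?case by (intro gradient_of_eqI) (simp add: g_minus)
qed

end

context interchange_sequence
begin

lemma energy_difference_limit:
  fixes W :: "real^'d^'m \<Rightarrow> real"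
  assumes W_cont: "continuous_on UNIV W"
    and Wp: "W differentiable (at Fp)" and Wm: "W differentiable (at Fm)"
    and jump: "Fp - Fm = outer a n"
    and ybar_plus: "\<And>z. 0 < z \<bullet> n \<Longrightarrow> ybar z = Fp *v z"
    and ybar_minus: "\<And>z. z \<bullet> n < 0 \<Longrightarrow> ybar z = Fm *v z"
  shows "(\<lambda>k. (1 / h k) * (LINT z:ball 0 1|lebesgue.
      W (jacobian ybar (at z) + jacobian (Phi a n \<eta> \<zeta> \<rho> (h k)) (at z)) - W (jacobian ybar (at z))))
    \<longlonglongrightarrow> - (\<omega> / 2) * frobenius (matrix_gradient W Fp - matrix_gradient W Fm) (Fp - Fm)"
proof -
  define wp where "wp p = W (Fp + outer a p)" for p
  \<comment> \<open>The sign of \<open>a\<close> absorbs the reflection: the lower half ball is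
    mapped to the upper one, the gradient changes sign there, and the same half ball limit applies
    to \<open>wm\<close>.\<close>
  define wm where "wm p = W (Fm + outer (- a) p)" for p
  have cw: "continuous_on UNIV (\<lambda>p. W (F + outer b p))" for F b
    by (rule continuous_on_compose2[OF W_cont])
       (auto intro!: continuous_on_add continuous_on_const linear_continuous_on[OF bounded_linear_outer])
  have contp: "continuous_on UNIV wp" and contm: "continuous_on UNIV wm"
    unfolding wp_def wm_def by (rule cw)+
  have [measurable]: "wp \<in> borel_measurable borel" "wm \<in> borel_measurable borel"
    using contp contm by (auto intro: borel_measurable_continuous_onI)
  obtain qp where qp: "(wp has_derivative (\<lambda>p. qp \<bullet> p)) (at 0)"
    "\<And>p. qp \<bullet> p = matrix_gradient W Fp \<bullet> outer a p"
    unfolding wp_def[abs_def] by (rule gradient_along_rank_one[OF Wp, of a]) blast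
  obtain qm where qm: "(wm has_derivative (\<lambda>p. qm \<bullet> p)) (at 0)"
    "\<And>p. qm \<bullet> p = matrix_gradient W Fm \<bullet> outer (- a) p"
    unfolding wm_def[abs_def] by (rule gradient_along_rank_one[OF Wm, of "- a"]) blast
  have neg: "outer (- b) p = - outer b p" "outer b (- p) = - outer b p" "outer b 0 = 0" for b :: "real^'m" and p :: "real^'d"
    by (simp_all add: outer_def vec_eq_iff)
  have jac_plus: "jacobian ybar (at z) = Fp" if "0 < z \<bullet> n" for z
  proof -
    have "((\<lambda>z. Fp *v z) has_derivative (*v) Fp) (at z)"
      by (rule bounded_linear_imp_has_derivative[OF matrix_vector_mul_bounded_linear])
    then have "(ybar has_derivative (*v) Fp) (at z)"
    proof (rule has_derivative_transform_within_open)
      show "open {z. 0 < z \<bullet> n}" by (intro open_Collect_less continuous_intros)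
    qed (use that in \<open>auto simp: ybar_plus\<close>)
    then show ?thesis by (simp add: jacobian_eqI)
  qed
  have jac_minus: "jacobian ybar (at z) = Fm" if "z \<bullet> n < 0" for z
  proof -
    have "((\<lambda>z. Fm *v z) has_derivative (*v) Fm) (at z)"
      by (rule bounded_linear_imp_has_derivative[OF matrix_vector_mul_bounded_linear])
    then have "(ybar has_derivative (*v) Fm) (at z)"
    proof (rule has_derivative_transform_within_open)
      show "open {z. z \<bullet> n < 0}" by (intro open_Collect_less continuous_intros)
    qed (use that in \<open>auto simp: ybar_minus\<close>)
    then show ?thesis by (simp add: jacobian_eqI)
  qed
  let ?H = "{z \<in> ball 0 1. 0 < z \<bullet> n}" and ?H' = "{z \<in> ball 0 1. z \<bullet> n < 0}"
  have "(LINT z:ball 0 1|lebesgue.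
      W (jacobian ybar (at z) + jacobian (Phi a n \<eta> \<zeta> \<rho> (h k)) (at z)) - W (jacobian ybar (at z))) =
    (\<integral>z. indicator ?H z * (wp (u k z) - wp 0) \<partial>lborel) + (\<integral>z. indicator ?H z * (wm (u k z) - wm 0) \<partial>lborel)"
    (is "?I k = _") for k
  proof -
    let ?f = "\<lambda>z. indicator ?H z * (wp (u k z) - wp 0) + indicator ?H' z * (wm (- u k z) - wm 0)"
    have fm: "?f \<in> borel_measurable borel" by measurable
    have ae: "AE z in lborel. ?f z = indicator (ball 0 1) z *\<^sub>R
      (W (jacobian ybar (at z) + jacobian (Phi a n \<eta> \<zeta> \<rho> (h k)) (at z)) - W (jacobian ybar (at z)))"
      using prof.AE_der[of k] hyperplane_AE[of 0]
    proof eventually_elim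
      case (elim z)
      have J: "jacobian (Phi a n \<eta> \<zeta> \<rho> (h k)) (at z) = outer a (u k z)"
        by (rule prof.jacobian_Phi[where \<zeta>f = \<zeta>, OF refl elim(1)])
      consider "0 < z \<bullet> n" | "z \<bullet> n < 0" using elim(2) by linarith
      then show ?case
        by cases (simp_all add: J jac_plus jac_minus wp_def wm_def neg indicator_def)
    qed
    \<comment> \<open>The integrand contains Jacobians at points where they need not exist. It
      agrees almost everywhere with the Borel function \<open>?f\<close>, and completeness of
      Lebesgue measure makes it measurable.\<close>
    have "?I k = (\<integral>z. ?f z \<partial>lebesgue)"
      unfolding set_lebesgue_integral_def
    proof (rule integral_cong_AE)
      show fl: "?f \<in> borel_measurable lebesgue" using fm by (intro measurable_completion) simp
      show "(\<lambda>z. indicator (ball 0 1) z *\<^sub>R (W (jacobian ybar (at z) +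
        jacobian (Phi a n \<eta> \<zeta> \<rho> (h k)) (at z)) - W (jacobian ybar (at z)))) \<in> borel_measurable lebesgue"
        by (rule borel_measurable_AE[OF fl AE_completion[OF ae]])
      show "AE z in lebesgue. indicator (ball 0 1) z *\<^sub>R (W (jacobian ybar (at z) +
        jacobian (Phi a n \<eta> \<zeta> \<rho> (h k)) (at z)) - W (jacobian ybar (at z))) = ?f z"
        using AE_completion[OF ae] by eventually_elim simp
    qed
    also have "\<dots> = (\<integral>z. ?f z \<partial>lborel)" using fm by (intro integral_completion) simp
    also have "\<dots> = (\<integral>z. indicator ?H z * (wp (u k z) - wp 0) \<partial>lborel) + (\<integral>z. indicator ?H' z * (wm (- u k z) - wm 0) \<partial>lborel)"
    proof (rule Bochner_Integration.integral_add)
      show "integrable lborel (\<lambda>z. indicator ?H z * (wp (u k z) - wp 0))"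
        by (rule integrable_bounded_density[where r = "\<lambda>p. wp p - wp 0"]) (auto intro!: continuous_intros contp)
      show "integrable lborel (\<lambda>z. indicator ?H' z * (wm (- u k z) - wm 0))"
        by (rule integrable_bounded_density[where r = "\<lambda>p. wm (- p) - wm 0"])
           (auto intro!: continuous_intros continuous_on_compose2[OF contm])
    qed
    also have "(\<integral>z. indicator ?H' z * (wm (- u k z) - wm 0) \<partial>lborel) =
      (\<integral>z. indicator ?H' (- z) * (wm (- u k (- z)) - wm 0) \<partial>lborel)"
      by (rule integral_lborel_reflect[symmetric]) measurable
    also have "\<dots> = (\<integral>z. indicator ?H z * (wm (u k z) - wm 0) \<partial>lborel)"
    proof (rule integral_cong_AE)
      show "AE z in lborel. indicator ?H' (- z) * (wm (- u k (- z)) - wm 0) = indicator ?H z * (wm (u k z) - wm 0)"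
        using prof.AE_v_odd[of k] by eventually_elim (simp add: indicator_def)
    qed measurable
    finally show ?thesis .
  qed
  then have "(\<lambda>k. (1 / h k) * ?I k) = (\<lambda>k. (1 / h k) * (\<integral>z. indicator ?H z * (wp (u k z) - wp 0) \<partial>lborel)
      + (1 / h k) * (\<integral>z. indicator ?H z * (wm (u k z) - wm 0) \<partial>lborel))"
    by (simp add: fun_eq_iff distrib_left)
  moreover have "\<dots> \<longlonglongrightarrow> \<omega> / 2 * (wp (- n) - wp 0 - qp \<bullet> n) + \<omega> / 2 * (wm (- n) - wm 0 - qm \<bullet> n)"
    by (intro tendsto_add half_ball_limit contp contm qp qm)
  moreover have "\<omega> / 2 * (wp (- n) - wp 0 - qp \<bullet> n) + \<omega> / 2 * (wm (- n) - wm 0 - qm \<bullet> n) =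
    - (\<omega> / 2) * frobenius (matrix_gradient W Fp - matrix_gradient W Fm) (Fp - Fm)"
  proof -
    \<comment> \<open>The four values cancel in the sum. The gradient terms do not, since
      \<open>outer (- a)\<close> in \<open>qm\<close> puts a minus sign before the gradient at
      \<open>Fm\<close>.\<close>
    have "wp (- n) = W Fm" "wm (- n) = W Fp" "wp 0 = W Fp" "wm 0 = W Fm"
      using jump by (simp_all add: wp_def wm_def neg algebra_simps)
    then show ?thesis
      by (simp add: qp qm neg jump frobenius_eq_inner inner_diff_left algebra_simps)
  qed
  ultimately show ?thesis by (simp only:)
qed

end

theorem theorem3p1:
  fixes W :: "real^'d^'m \<Rightarrow> real"
    and Fp Fm :: "real^'d^'m"
    and a :: "real^'m"
    and n \<eta> :: "real^'d"
    and \<zeta> :: "real \<Rightarrow> real \<Rightarrow> real"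
    and \<rho> :: "real \<Rightarrow> real"
    and C L :: real
    and ybar :: "real^'d \<Rightarrow> real^'m"
  assumes W_cont: "continuous_on UNIV W"
    and W_bdd_below: "bdd_below (range W)"
    and W_C2: "\<exists>U. Fp \<in> U \<and> Fm \<in> U \<and> C2_on U W"
    and jump: "Fp - Fm = outer a n"
    and n_unit: "norm n = 1"
    and eta_unit: "norm \<eta> = 1"
    and eta_perp: "\<eta> \<bullet> n = 0"
    and zeta_lip: "\<And>h. 0 < h \<Longrightarrow> h < 1 \<Longrightarrow> (C / sqrt h)-lipschitz_on {0..} (\<zeta> h)"
    and zeta_one: "\<And>h t. 0 < h \<Longrightarrow> h < 1 \<Longrightarrow> 0 \<le> t \<Longrightarrow> t \<le> 1 - sqrt h \<Longrightarrow> \<zeta> h t = 1"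
    and zeta_zero: "\<And>h t. 0 < h \<Longrightarrow> h < 1 \<Longrightarrow> 1 \<le> t \<Longrightarrow> \<zeta> h t = 0"
    and rho_lip: "L-lipschitz_on UNIV \<rho>"
    and rho_one: "\<And>t. 1 < t \<Longrightarrow> \<rho> t = 1"
    and rho_zero: "\<And>t. t < 0 \<Longrightarrow> \<rho> t = 0"
    and ybar_plus: "\<And>z. 0 < z \<bullet> n \<Longrightarrow> ybar z = Fp *v z"
    and ybar_minus: "\<And>z. z \<bullet> n < 0 \<Longrightarrow> ybar z = Fm *v z"
  shows "((\<lambda>h. (1 / h) *
            (LINT z:ball 0 1|lebesgue.
               W (jacobian ybar (at z) + jacobian (Phi a n \<eta> \<zeta> \<rho> h) (at z))
               - W (jacobian ybar (at z))))
          \<longlongrightarrow> - (unit_ball_vol (real CARD('d) - 1) / 2)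
              * frobenius (matrix_gradient W Fp - matrix_gradient W Fm) (Fp - Fm))
         (at_right 0)"
proof (rule tendsto_at_right_sequentially[OF zero_less_one])
  fix h :: "nat \<Rightarrow> real"
  assume h: "\<And>k. 0 < h k" "\<And>k. h k < 1" "h \<longlonglongrightarrow> 0"
  obtain \<nu> :: "(real^'d \<Rightarrow> real) measure" and E where "slicing \<nu> n E"
    by (rule slicing_exists[OF n_unit])
  have "interchange_sequence \<nu> n E \<eta> h C L \<zeta> \<rho>"
  proof (intro interchange_sequence.intro interchange_sequence_axioms.intro)
    show "slicing \<nu> n E" by fact
    show "interchange_profile n \<eta> (h k) C L (\<zeta> (h k)) \<rho>" for k
      by standard (use h assms in auto)
    show "h \<longlonglongrightarrow> 0" by fact
  qed
  then interpret interchange_sequence \<nu> n E \<eta> h C L \<zeta> \<rho> .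
  have "W differentiable (at Fp)" "W differentiable (at Fm)"
    using W_C2 C2_on_differentiable by blast+
  from energy_difference_limit[OF W_cont this jump ybar_plus ybar_minus]
  show "(\<lambda>k. (1 / h k) * (LINT z:ball 0 1|lebesgue.
        W (jacobian ybar (at z) + jacobian (Phi a n \<eta> \<zeta> \<rho> (h k)) (at z)) - W (jacobian ybar (at z))))
    \<longlonglongrightarrow> - (unit_ball_vol (real CARD('d) - 1) / 2)
      * frobenius (matrix_gradient W Fp - matrix_gradient W Fm) (Fp - Fm)"
    by (simp add: \<omega>_def)
qed

end
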